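(* Let $\theta,\delta>0$ with $\delta+\theta<1/4$. There is $N_0$ (depending on $\theta$, $\delta$ and on the functions implicit in the definition of $\mathcal{C}'$ below) such that the following holds for all $N\ge N_0$: if $C\subset \mathcal{C}'(N,N^{1+\delta};\theta)$ and $$\sum_{n\in C}\frac1n>6,$$ then there exists a subset $S\subset C$ with $\sum_{n\in S}1/n=1$.
   Context: For real $X\le Y$ and $\theta>0$, $\mathcal{C}(X,Y;\theta)$ denotes the set of integers $n\in[X,Y]$ all of whose prime power divisors $p^a$ ($p$ prime, $a\ge1$, $p^a\mid n$) satisfy $p^a\le X^\theta$. $\mathcal{C}'(X,Y;\theta)$ denotes the set of $n\in\mathcal{C}(X,Y;\theta)$ with $\omega(n)\sim\Omega(n)\sim\log\log n$, where $\omega(n)$ is the number of distinct prime divisors of $n$ and $\Omega(n)$ is the number of prime power divisors of $n$ (prime factors counted with multiplicity); concretely, $|\omega(n)/\log\log n-1|\le\epsilon(n)$ and $|\Omega(n)/\log\log n-1|\le \epsilon(n)$ for a fixed function $\epsilon(n)\to0$ as $n\to\infty$. *)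

theory Defs
  imports Complex_Main "HOL-Computational_Algebra.Primes"
begin

definition omega :: "nat \<Rightarrow> nat" where
  "omega n = card (prime_factors n)"

definition bigomega :: "nat \<Rightarrow> nat" where
  "bigomega n = size (prime_factorization n)"

(* The range of n is nat, so the notion is meant for X > 0.
   The number 0 is never a member: every p^a divides it. *)
definition smooth_ints :: "real \<Rightarrow> real \<Rightarrow> real \<Rightarrow> nat set" where
  "smooth_ints X Y \<theta> =
     {n. X \<le> real n \<and> real n \<le> Y \<and>
         (\<forall>p a. prime p \<and> 1 \<le> a \<and> p ^ a dvd n \<longrightarrow> real (p ^ a) \<le> X powr \<theta>)}"

(* The error function \<epsilon>, a parameter here, quantifies omega n ~ Omega n ~ log log n. *)
definition smooth_normal_ints ::
    "(nat \<Rightarrow> real) \<Rightarrow> real \<Rightarrow> real \<Rightarrow> real \<Rightarrow> nat set" where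
  "smooth_normal_ints \<epsilon> X Y \<theta> =
     {n \<in> smooth_ints X Y \<theta>.
        \<bar>real (omega n) / ln (ln (real n)) - 1\<bar> \<le> \<epsilon> n \<and>
        \<bar>real (bigomega n) / ln (ln (real n)) - 1\<bar> \<le> \<epsilon> n}"

end

theory Submission
  imports Defs "HOL-Number_Theory.Prime_Powers" "HOL-Real_Asymp.Real_Asymp"
    "HOL-Analysis.Infinite_Products" "HOL-Analysis.Harmonic_Numbers"
begin

text \<open>Choose each \<open>n \<in> D\<close> independently with probability \<open>p = 1 / (\<Sum>n\<in>D. 1 / n)\<close>, so that the
  random subset sum has mean \<open>1\<close>. By Fourier inversion modulo \<open>P = lcm D\<close> it is an integer with
  probability about \<open>1 / P\<close>, unless some frequency \<open>h\<close> modulo \<open>P\<close> away from \<open>0\<close> has almost all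
  \<open>n \<in> D\<close> dividing an integer within \<open>K = N powr (3 / 4)\<close> of \<open>h\<close>. The values \<open>0\<close> and \<open>\<ge> 2\<close> are
  far less likely than \<open>1 / P\<close>, so the value \<open>1\<close> must occur.

  For such an \<open>h\<close>, and provided \<open>D\<close> is pruned so that the elements with a given exact prime
  power \<open>q\<close> never have negligible total mass, each \<open>q\<close> divides an integer \<open>x\<close> near \<open>h\<close> that is rich: the
  reciprocals of the prime powers dividing \<open>x\<close> sum to more than \<open>0.35 ln (ln N)\<close>, a constant below
  \<open>1 / e\<close>. This is where \<open>\<omega>(n) \<sim> ln (ln n)\<close> enters. Two distinct integers near \<open>h\<close> share few prime
  powers, whereas all prime powers up to \<open>N powr \<theta>\<close> contribute \<open>ln (ln N) + O(1)\<close>; as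
  \<open>3 \<cdot> 0.35 > 1\<close>, there cannot be three essentially disjoint rich sets. If two rich integers occur,
  one of them has a set of divisors in \<open>D\<close> of mass above \<open>2\<close>, and restricting to that set excludes
  any further splitting. A single rich integer is a common multiple of \<open>D\<close>, so \<open>h\<close> is near \<open>0\<close>
  modulo \<open>P\<close>.\<close>

section \<open>Mertens-type upper bounds\<close>

text \<open>By symmetry the lower half of row \<open>2 * m + 1\<close> sums to
  \<open>2 ^ (2 * m)\<close>, and the coefficient is one of its terms.\<close>

lemma central_binomial_le: "(2 * m + 1) choose m \<le> 4 ^ m"
proof -
  have "(2 * m + 1) choose m \<le> (\<Sum>k\<le>m. (2 * m + 1) choose k)"
    by (rule member_le_sum) auto
  also have "\<dots> = 2 ^ (2 * m)"
    by (rule binomial_r_part_sum)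
  finally show ?thesis
    by (simp add: power_mult)
qed

lemma prod_pairwise_coprime_dvd:
  fixes n :: nat
  assumes "finite A" "\<And>a. a \<in> A \<Longrightarrow> a dvd n" "\<And>a b. a \<in> A \<Longrightarrow> b \<in> A \<Longrightarrow> a \<noteq> b \<Longrightarrow> coprime a b"
  shows "\<Prod>A dvd n"
  using assms
proof (induction A rule: finite_induct)
  case (insert a A)
  have "coprime a (\<Prod>A)" using insert by (intro prod_coprime_right) auto
  moreover have "a dvd n" "\<Prod>A dvd n" using insert by auto
  ultimately show ?case using insert by (simp add: divides_mult)
qed simp

text \<open>Erdos's induction: for \<open>n = 2 * m + 1\<close> the primes in
  \<open>(m + 1, n]\<close> all divide \<open>n choose m\<close>, which is at most
  \<open>4 ^ m\<close>, and the induction hypothesis at \<open>m + 1\<close> covers the rest. An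
  even \<open>n > 2\<close> is not prime and reduces to \<open>n - 1\<close>.\<close>

lemma primorial_le: "(\<Prod>p | prime p \<and> p \<le> n. p) \<le> (4::nat) ^ n"
proof (induction n rule: less_induct)
  case (less n)
  show ?case
  proof (cases "n \<le> 2")
    case True
    then consider "n = 0" | "n = 1" | "n = 2" by linarith
    then show ?thesis
    proof cases
      case 3
      have "{p::nat. prime p \<and> p \<le> 2} = {2}"
        by (auto dest: prime_ge_2_nat)
      with 3 show ?thesis by simp
    next
      case 2
      have e: "{p::nat. prime p \<and> p \<le> 1} = {}"
        by (auto dest: prime_ge_2_nat)
      show ?thesis unfolding 2 e by simp
    next
      case 1
      have e: "{p::nat. prime p \<and> p \<le> 0} = {}"
        by (auto dest: prime_ge_2_nat)
      show ?thesis unfolding 1 e by simp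
    qed
  next
    case False
    show ?thesis
    proof (cases "even n")
      case True
      have "\<not> prime n" using True False prime_odd_nat[of n] by auto
      hence "{p. prime p \<and> p \<le> n} = {p. prime p \<and> p \<le> n - 1}"
        using False by (auto simp: le_less)
      moreover have "(\<Prod>p | prime p \<and> p \<le> n - 1. p) \<le> (4::nat) ^ (n - 1)"
        using less[of "n - 1"] False by simp
      moreover have "(4::nat) ^ (n - 1) \<le> 4 ^ n" by (rule power_increasing) auto
      ultimately show ?thesis by (metis order_trans)
    next
      case odd: False
      then obtain m where m: "n = 2 * m + 1" by (auto elim: oddE)
      have m1: "m \<ge> 1" using False m by simp
      let ?A = "{p. prime p \<and> p \<le> m + 1}" and ?B = "{p. prime p \<and> m + 1 < p \<and> p \<le> n}"
      have "{p. prime p \<and> p \<le> n} = ?A \<union> ?B" using m by auto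
      hence "(\<Prod>p | prime p \<and> p \<le> n. p) = \<Prod>?A * \<Prod>?B"
        by (simp only:) (rule prod.union_disjoint, auto)
      moreover have "\<Prod>?A \<le> 4 ^ (m + 1)" using less[of "m + 1"] m m1 by simp
      moreover have "\<Prod>?B \<le> 4 ^ m"
      proof -
        have "\<Prod>?B dvd (n choose m)"
        proof (rule prod_pairwise_coprime_dvd)
          fix p assume p: "p \<in> ?B"
          hence "p dvd fact n" using prime_dvd_fact_iff[of p n] by auto
          moreover have "fact n = fact m * fact (n - m) * (n choose m)"
            using binomial_fact_lemma[of m n] m by simp
          moreover have "\<not> p dvd fact m" "\<not> p dvd fact (n - m)"
            using p m prime_dvd_fact_iff[of p m] prime_dvd_fact_iff[of p "n - m"] by auto
          ultimately show "p dvd (n choose m)" using p by (auto simp: prime_dvd_mult_iff)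
        qed (auto intro: primes_coprime)
        hence "\<Prod>?B \<le> n choose m" using m by (intro dvd_imp_le) auto
        also have "\<dots> \<le> 4 ^ m" using central_binomial_le[of m] m by simp
        finally show ?thesis .
      qed
      ultimately have "(\<Prod>p | prime p \<and> p \<le> n. p) \<le> 4 ^ (m + 1) * 4 ^ m"
        using mult_le_mono[of "\<Prod>?A" _ "\<Prod>?B"] by simp
      also have "\<dots> = 4 ^ n" by (simp add: m mult_2 power_add)
      finally show ?thesis .
    qed
  qed
qed

lemma sum_ln_primes_le: "(\<Sum>p | prime p \<and> p \<le> n. ln (real p)) \<le> ln 4 * real n"
proof -
  have "(\<Sum>p | prime p \<and> p \<le> n. ln (real p)) = ln (\<Prod>p | prime p \<and> p \<le> n. real p)"
    by (subst ln_prod) (auto dest: prime_gt_0_nat)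
  also have "(\<Prod>p | prime p \<and> p \<le> n. real p) = real (\<Prod>p | prime p \<and> p \<le> n. p)"
    by simp
  also have "ln \<dots> \<le> ln (real (4 ^ n))"
    by (subst ln_le_cancel_iff)
       (use primorial_le[of n] in \<open>auto intro!: prod_pos dest: prime_gt_0_nat simp del: of_nat_prod of_nat_power\<close>)
  also have "\<dots> = ln 4 * real n" by (simp add: ln_realpow)
  finally show ?thesis .
qed

text \<open>Legendre's formula for \<open>n!\<close> with only the first powers kept: the primes
  dividing \<open>m\<close> contribute at most the full von Mangoldt sum over the divisors of
  \<open>m\<close>, which is \<open>ln m\<close>.\<close>

lemma ln_fact_ge_sum_primes:
  "(\<Sum>p | prime p \<and> p \<le> n. ln (real p) * real (n div p)) \<le> ln (fact n)"
proof -
  let ?Pr = "{p. prime p \<and> p \<le> n}"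
  have "(\<Sum>p\<in>?Pr. ln (real p) * real (n div p)) =
          (\<Sum>p\<in>?Pr. \<Sum>m | m \<in> {1..n} \<and> p dvd m. ln (real p))"
  proof (rule sum.cong)
    fix p assume p: "p \<in> ?Pr"
    hence "p > 0" by (auto dest: prime_gt_0_nat)
    have "{m. m \<in> {1..n} \<and> p dvd m} = (\<lambda>k. p * k) ` {1..n div p}"
      using \<open>p > 0\<close> by (auto simp: less_eq_div_iff_mult_less_eq mult.commute elim!: dvdE intro!: imageI)
    moreover have "inj_on (\<lambda>k. p * k) {1..n div p}" using \<open>p > 0\<close> by (auto intro: inj_onI)
    ultimately have "card {m. m \<in> {1..n} \<and> p dvd m} = n div p" by (simp add: card_image)
    thus "ln (real p) * real (n div p) = (\<Sum>m | m \<in> {1..n} \<and> p dvd m. ln (real p))" by simp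
  qed auto
  also have "\<dots> = (\<Sum>m\<in>{1..n}. \<Sum>p | p \<in> ?Pr \<and> p dvd m. ln (real p))"
    by (rule sum.swap_restrict) auto
  also have "\<dots> \<le> (\<Sum>m\<in>{1..n}. ln (real m))"
  proof (rule sum_mono)
    fix m assume m: "m \<in> {1..n}"
    have "(\<Sum>p | p \<in> ?Pr \<and> p dvd m. ln (real p)) = (\<Sum>p | p \<in> ?Pr \<and> p dvd m. mangoldt p)"
      by (rule sum.cong) auto
    also have "\<dots> \<le> (\<Sum>d | d dvd m. mangoldt d)"
      using m by (intro sum_mono2) (auto simp: mangoldt_nonneg)
    also have "\<dots> = ln (real m)" using mangoldt_sum[of m, where 'a=real] m by simp
    finally show "(\<Sum>p | p \<in> ?Pr \<and> p dvd m. ln (real p)) \<le> ln (real m)" .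
  qed
  also have "\<dots> = ln (fact n)"
    unfolding fact_prod of_nat_prod by (subst ln_prod) auto
  finally show ?thesis .
qed

text \<open>Replacing \<open>n div p\<close> by \<open>n / p - 1\<close> in the Legendre bound loses
  at most the Chebyshev sum, which is at most \<open>ln 4 * n\<close>. Then
  \<open>ln (n!) <= n * ln n\<close> and division by \<open>n\<close> finish.\<close>

lemma mertens_first_upper:
  assumes "n \<ge> 1"
  shows "(\<Sum>p | prime p \<and> p \<le> n. ln (real p) / real p) \<le> ln (real n) + ln 4"
proof -
  let ?Pr = "{p. prime p \<and> p \<le> n}"
  have "real n * (\<Sum>p\<in>?Pr. ln (real p) / real p) - ln 4 * real n
        \<le> (\<Sum>p\<in>?Pr. real n * (ln (real p) / real p)) - (\<Sum>p\<in>?Pr. ln (real p))"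
    using sum_ln_primes_le[of n] by (simp add: sum_distrib_left)
  also have "\<dots> = (\<Sum>p\<in>?Pr. ln (real p) * (real n / real p - 1))"
    by (simp add: sum_subtractf[symmetric] algebra_simps)
  also have "\<dots> \<le> (\<Sum>p\<in>?Pr. ln (real p) * real (n div p))"
  proof (rule sum_mono)
    fix p assume p: "p \<in> ?Pr"
    hence "p > 0" by (auto dest: prime_gt_0_nat)
    have "n \<le> p * (n div p) + p"
      using mod_less_divisor[OF \<open>p > 0\<close>, of n] mult_div_mod_eq[of p n] by linarith
    hence "real n \<le> real p * real (n div p) + real p"
      by (metis of_nat_add of_nat_le_iff of_nat_mult)
    hence "real n / real p - 1 \<le> real (n div p)"
      using \<open>p > 0\<close> by (simp add: field_simps)
    thus "ln (real p) * (real n / real p - 1) \<le> ln (real p) * real (n div p)"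
      using \<open>p > 0\<close> by (intro mult_left_mono) auto
  qed
  also have "\<dots> \<le> ln (fact n)" by (rule ln_fact_ge_sum_primes)
  also have "\<dots> \<le> ln (real n ^ n)"
    using assms fact_le_power[of n, where 'a=real] by (subst ln_le_cancel_iff) auto
  also have "\<dots> = real n * ln (real n)" using assms by (simp add: ln_realpow)
  finally have "real n * (\<Sum>p\<in>?Pr. ln (real p) / real p) \<le> real n * (ln (real n) + ln 4)"
    by (simp add: algebra_simps)
  thus ?thesis using assms by simp
qed

section \<open>Partial summation and the sum of reciprocals of primes\<close>

lemma ln_reciprocal_step:
  assumes "n \<ge> (2::nat)"
  shows "ln (real n) * (1 / ln (real n) - 1 / ln (real (Suc n)))
         \<le> ln (ln (real (Suc n))) - ln (ln (real n))"
proof -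
  let ?a = "ln (real n)" and ?b = "ln (real (Suc n))"
  have a: "?a > 0" and b: "?b > 0" using assms by auto
  have "?a * (1 / ?a - 1 / ?b) = 1 - ?a / ?b" using a b by (simp add: field_simps)
  also have "\<dots> \<le> - ln (?a / ?b)" using ln_le_minus_one[of "?a / ?b"] a b by simp
  also have "\<dots> = ln ?b - ln ?a" using a b by (simp add: ln_div)
  finally show ?thesis .
qed

lemma partial_summation_ln:
  fixes a :: "nat \<Rightarrow> real"
  assumes B: "\<And>n. m < n \<Longrightarrow> (\<Sum>i\<in>{m<..n}. a i) \<le> ln (real n) + c" and m: "m \<ge> 2" and c: "c \<ge> 0"
    and "m < n"
  shows "(\<Sum>i\<in>{m<..n}. a i / ln (real i)) \<le> 1 + ln (ln (real n)) - ln (ln (real m)) + c / ln (real m)"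
proof -
  define A where "A n = (\<Sum>i\<in>{m<..n}. a i)" for n
  \<comment> \<open>The boundary term \<open>A n / ln n\<close> is kept exact; the bound on
    \<open>A\<close> is applied only against the differences of \<open>1 / ln\<close>, whose main
    part telescopes to a difference of \<open>ln ln\<close>.\<close>
  have Abel: "(\<Sum>i\<in>{m<..n}. a i / ln (real i)) \<le>
      A n / ln (real n) + ln (ln (real n)) - ln (ln (real m)) + c * (1 / ln (real m) - 1 / ln (real n))"
    if "m \<le> n" for n
    using that
  proof (induction n rule: dec_induct)
    case base
    show ?case by (simp add: A_def)
  next
    case (step n)
    have pos: "ln (real n) > 0" "ln (real (Suc n)) > 0" "ln (real n) \<le> ln (real (Suc n))"
      using step m by auto
    have An: "A n \<le> ln (real n) + c"
    proof (cases "n = m")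
      case True thus ?thesis using c pos by (simp add: A_def)
    next
      case False thus ?thesis using B[of n] step by (simp add: A_def)
    qed
    have split: "{m<..Suc n} = insert (Suc n) {m<..n}" using step by auto
    have AS: "A (Suc n) = a (Suc n) + A n" by (simp add: A_def split)
    let ?d = "1 / ln (real n) - 1 / ln (real (Suc n))"
    have d: "?d \<ge> 0" using pos by (simp add: frac_le)
    have "(\<Sum>i\<in>{m<..Suc n}. a i / ln (real i)) = a (Suc n) / ln (real (Suc n)) + (\<Sum>i\<in>{m<..n}. a i / ln (real i))"
      by (simp add: split)
    also have "\<dots> \<le> a (Suc n) / ln (real (Suc n)) +
        (A n / ln (real n) + ln (ln (real n)) - ln (ln (real m)) + c * (1 / ln (real m) - 1 / ln (real n)))"
      using step by simp
    also have "A n / ln (real n) = A n / ln (real (Suc n)) + A n * ?d" by (simp add: algebra_simps)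
    also have "A n * ?d \<le> (ln (real n) + c) * ?d" using An d by (rule mult_right_mono)
    also have "\<dots> \<le> (ln (ln (real (Suc n))) - ln (ln (real n))) + c * ?d"
      using ln_reciprocal_step[of n] step m by (simp add: distrib_right)
    finally show ?case by (simp add: AS algebra_simps add_divide_distrib)
  qed
  have pos: "ln (real n) > 0" "ln (real m) > 0" using assms by auto
  have "A n / ln (real n) \<le> (ln (real n) + c) / ln (real n)"
    using B[of n] assms pos by (intro divide_right_mono) (auto simp: A_def)
  also have "\<dots> = 1 + c / ln (real n)" using pos by (simp add: field_simps)
  finally show ?thesis using Abel[of n] assms by (simp add: algebra_simps)
qed

lemma sum_reciprocal_primes_between:
  assumes m: "m \<ge> (2::nat)" and "m \<le> n"
  shows "(\<Sum>p | prime p \<and> m < p \<and> p \<le> n. 1 / real p) \<le> ln (ln (real n)) - ln (ln (real m)) + 4"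
proof (cases "m = n")
  case True
  hence e: "{p. prime p \<and> m < p \<and> p \<le> n} = {}" by auto
  show ?thesis unfolding e using True by simp
next
  case False
  define a where "a i = (if prime i then ln (real i) / real i else 0)" for i :: nat
  have "(\<Sum>p | prime p \<and> m < p \<and> p \<le> n. 1 / real p) = (\<Sum>i\<in>{m<..n}. a i / ln (real i))"
  proof -
    have "(\<Sum>i\<in>{m<..n}. a i / ln (real i)) = (\<Sum>i\<in>{i\<in>{m<..n}. prime i}. a i / ln (real i))"
      by (rule sum.mono_neutral_right) (auto simp: a_def)
    also have "{i\<in>{m<..n}. prime i} = {p. prime p \<and> m < p \<and> p \<le> n}" by auto
    also have "(\<Sum>i | prime i \<and> m < i \<and> i \<le> n. a i / ln (real i)) = (\<Sum>i | prime i \<and> m < i \<and> i \<le> n. 1 / real i)"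
    proof (rule sum.cong)
      fix i assume i: "i \<in> {p. prime p \<and> m < p \<and> p \<le> n}"
      hence "ln (real i) > 0" using m by simp
      thus "a i / ln (real i) = 1 / real i" using i by (simp add: a_def)
    qed simp
    finally show ?thesis ..
  qed
  also have "\<dots> \<le> 1 + ln (ln (real n)) - ln (ln (real m)) + ln 4 / ln (real m)"
  proof (rule partial_summation_ln)
    fix n assume "m < n"
    have "(\<Sum>i\<in>{m<..n}. a i) \<le> (\<Sum>i\<in>{..n}. a i)"
      by (rule sum_mono2) (auto simp: a_def dest: prime_gt_0_nat)
    also have "\<dots> = (\<Sum>i\<in>{i\<in>{..n}. prime i}. a i)"
      by (rule sum.mono_neutral_right) (auto simp: a_def)
    also have "{i\<in>{..n}. prime i} = {p. prime p \<and> p \<le> n}" by auto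
    also have "(\<Sum>i | prime i \<and> i \<le> n. a i) = (\<Sum>i | prime i \<and> i \<le> n. ln (real i) / real i)"
      by (rule sum.cong) (auto simp: a_def)
    also have "\<dots> \<le> ln (real n) + ln 4" using \<open>m < n\<close> by (intro mertens_first_upper) auto
    finally show "(\<Sum>i\<in>{m<..n}. a i) \<le> ln (real n) + ln 4" .
  qed (use assms False in auto)
  also have "ln 4 / ln (real m) \<le> 2"
  proof -
    have "ln 4 = 2 * ln (2::real)" using ln_realpow[of 2 2] by simp
    moreover have "ln 2 \<le> ln (real m)" using m by simp
    moreover have "ln (2::real) > 0" by simp
    ultimately show ?thesis using m by (simp add: divide_le_eq)
  qed
  finally show ?thesis by simp
qed

text \<open>Each element is encoded by its base and its exponent minus 2. Even over all integers
  \<open>p >= 2\<close>, the geometric series starting at \<open>1 / p^2\<close> sums to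
  \<open>1 / (p - 1) - 1 / p\<close>, which telescopes to 1.\<close>

lemma sum_reciprocal_higher_prime_powers:
  assumes "finite R" "\<And>r. r \<in> R \<Longrightarrow> primepow r \<and> \<not> prime r"
  shows "(\<Sum>r\<in>R. 1 / real r) \<le> 1"
proof -
  have ex: "\<exists>p a. prime p \<and> r = p ^ Suc (Suc a)" if "r \<in> R" for r
  proof -
    from assms(2)[OF that] obtain p k where pk: "prime p" "k > 0" "r = p ^ k" "\<not> prime r"
      by (auto simp: primepow_def)
    hence "k \<noteq> 1" by auto
    then obtain a where "k = Suc (Suc a)" using pk by (metis One_nat_def not0_implies_Suc not_gr_zero)
    thus ?thesis using pk by auto
  qed
  then obtain f g where fg: "\<And>r. r \<in> R \<Longrightarrow> prime (f r) \<and> r = f r ^ Suc (Suc (g r))" by metis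
  \<comment> \<open>\<open>M\<close> and \<open>A\<close> only provide a finite box that contains
    all the encoded pairs.\<close>
  define M where "M = Suc (\<Sum>r\<in>R. f r)"
  define A where "A = Suc (\<Sum>r\<in>R. g r)"
  have fM: "f r < M" "g r < A" if "r \<in> R" for r
    unfolding M_def A_def less_Suc_eq_le using that assms(1) by (auto intro: member_le_sum)
  have inj: "inj_on (\<lambda>r. (f r, g r)) R" 
  proof (rule inj_onI)
    fix r s assume rs: "r \<in> R" "s \<in> R" "(f r, g r) = (f s, g s)"
    have "r = f r ^ Suc (Suc (g r))" "s = f s ^ Suc (Suc (g s))" using fg rs by blast+
    with rs(3) show "r = s" by (metis prod.inject)
  qed
  have "(\<Sum>r\<in>R. 1 / real r) = (\<Sum>r\<in>R. (\<lambda>(p, a). 1 / real (p ^ Suc (Suc a))) (f r, g r))"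
  proof (rule sum.cong)
    fix r assume "r \<in> R"
    hence "r = f r ^ Suc (Suc (g r))" using fg by blast
    hence "real r = real (f r ^ Suc (Suc (g r)))" by (rule arg_cong)
    thus "1 / real r = (\<lambda>(p, a). 1 / real (p ^ Suc (Suc a))) (f r, g r)" by (simp only: prod.case)
  qed simp
  also have "\<dots> = (\<Sum>(p, a)\<in>(\<lambda>r. (f r, g r)) ` R. 1 / real (p ^ Suc (Suc a)))"
    using inj by (subst sum.reindex) (auto simp: o_def)
  also have "\<dots> \<le> (\<Sum>(p, a)\<in>{2..<M+2} \<times> {..<A}. 1 / real (p ^ Suc (Suc a)))"
  proof (rule sum_mono2)
    show "(\<lambda>r. (f r, g r)) ` R \<subseteq> {2..<M+2} \<times> {..<A}"
    proof
      fix x assume "x \<in> (\<lambda>r. (f r, g r)) ` R"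
      then obtain r where r: "r \<in> R" "x = (f r, g r)" by blast
      have "f r \<ge> 2" using fg r by (auto dest: prime_ge_2_nat)
      thus "x \<in> {2..<M+2} \<times> {..<A}" using fM[of r] r by auto
    qed
  qed auto
  also have "\<dots> = (\<Sum>p\<in>{2..<M+2}. \<Sum>a<A. 1 / real (p ^ Suc (Suc a)))"
    by (simp add: sum.cartesian_product)
  also have "\<dots> \<le> (\<Sum>p\<in>{2..<M+2}. 1 / real (p - 1) - 1 / real p)"
  proof (rule sum_mono)
    fix p assume p: "p \<in> {2..<M+2}"
    define x where "x = 1 / real p"
    have x: "0 < x" "x \<le> 1/2" using p by (auto simp: x_def divide_simps)
    have "(\<Sum>a<A. 1 / real (p ^ Suc (Suc a))) = x^2 * (\<Sum>a<A. x ^ a)"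
      unfolding sum_distrib_left by (intro sum.cong refl) (simp add: x_def power_divide power2_eq_square)
    also have "(\<Sum>a<A. x ^ a) = (1 - x ^ A) / (1 - x)" using x by (simp add: sum_gp_strict)
    also have "\<dots> \<le> 1 / (1 - x)" using x by (intro divide_right_mono) auto
    also have "x^2 * (1 / (1 - x)) = 1 / real (p - 1) - 1 / real p"
    proof -
      have "real p - 1 > 0" "real (p - 1) = real p - 1" using p by (auto simp: of_nat_diff)
      thus ?thesis using p unfolding x_def by (simp add: divide_simps power2_eq_square)
    qed
    finally show "(\<Sum>a<A. 1 / real (p ^ Suc (Suc a))) \<le> 1 / real (p - 1) - 1 / real p"
      using x by (simp add: mult_left_mono)
  qed
  also have "(\<Sum>p\<in>{2..<M+2}. 1 / real (p - 1) - 1 / real p) = 1 - 1 / real (M + 1)"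
  proof (induction M)
    case (Suc M)
    have "{2..<Suc M + 2} = insert (M + 2) {2..<M + 2}" by auto
    thus ?case using Suc by simp
  qed simp
  also have "\<dots> \<le> 1" by simp
  finally show ?thesis .
qed

section \<open>Exact prime powers\<close>

text \<open>These are the prime powers exactly dividing \<open>n\<close>. Unlike all the prime power
  divisors, they are pairwise coprime, multiply to \<open>n\<close> and number
  \<open>omega n\<close>.\<close>

definition exact_pps :: "nat \<Rightarrow> nat set" where
  "exact_pps n = (\<lambda>p. p ^ multiplicity p n) ` prime_factors n"

definition rsum :: "nat set \<Rightarrow> real" where
  "rsum A = (\<Sum>n\<in>A. 1 / real n)"

lemma rsum_nonneg: "rsum A \<ge> 0"
  unfolding rsum_def by (intro sum_nonneg) auto

lemma rsum_mono: "finite B \<Longrightarrow> A \<subseteq> B \<Longrightarrow> rsum A \<le> rsum B"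
  unfolding rsum_def by (intro sum_mono2) auto

lemma rsum_Un_le: "finite A \<Longrightarrow> finite B \<Longrightarrow> rsum (A \<union> B) \<le> rsum A + rsum B"
  using sum.union_inter[of A B "\<lambda>n. 1 / real n"] rsum_nonneg[of "A \<inter> B"]
  unfolding rsum_def by linarith

lemma rsum_Diff: "finite B \<Longrightarrow> A \<subseteq> B \<Longrightarrow> rsum (B - A) = rsum B - rsum A"
  unfolding rsum_def by (rule sum_diff)

lemma finite_exact_pps [simp]: "finite (exact_pps n)"
  by (simp add: exact_pps_def)

lemma inj_on_exact_pps: "inj_on (\<lambda>p. p ^ multiplicity p n) (prime_factors n)"
proof (rule inj_onI)
  fix p q assume pq: "p \<in> prime_factors n" "q \<in> prime_factors n"
    and eq: "p ^ multiplicity p n = q ^ multiplicity q n"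
  from pq have "prime p" "prime q" "multiplicity p n > 0" by (simp_all add: prime_factors_multiplicity)
  moreover from this have "p dvd q ^ multiplicity q n" by (subst eq[symmetric]) simp
  ultimately show "p = q" by (metis prime_dvd_power primes_dvd_imp_eq)
qed

lemma card_exact_pps: "card (exact_pps n) = card (prime_factors n)"
  unfolding exact_pps_def by (rule card_image[OF inj_on_exact_pps])

lemma prod_exact_pps: "n > 0 \<Longrightarrow> \<Prod>(exact_pps n) = n"
  unfolding exact_pps_def using prime_factorization_nat[of n]
  by (subst prod.reindex[OF inj_on_exact_pps]) simp

lemma exact_pps_dvd: "q \<in> exact_pps n \<Longrightarrow> q dvd n"
  by (auto simp: exact_pps_def multiplicity_dvd)

lemma exact_pps_primepow: "q \<in> exact_pps n \<Longrightarrow> primepow q"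
  by (auto simp: exact_pps_def prime_factors_multiplicity)

lemma exact_pps_pos: "q \<in> exact_pps n \<Longrightarrow> q > 0"
  using exact_pps_primepow primepow_gt_0_nat by blast

lemma exact_pps_prime_power:
  assumes "q \<in> exact_pps n"
  obtains p a where "prime p" "a \<ge> 1" "q = p ^ a" "p ^ a dvd n"
proof -
  from assms obtain p where p: "p \<in> prime_factors n" "q = p ^ multiplicity p n"
    by (auto simp: exact_pps_def)
  hence "prime p" "multiplicity p n \<ge> 1"
    by (auto simp: prime_factors_multiplicity)
  thus ?thesis using that p multiplicity_dvd by blast
qed

lemma dvd_if_exact_pps_dvd:
  fixes x :: int
  assumes "n > 0" "\<And>q. q \<in> exact_pps n \<Longrightarrow> int q dvd x"
  shows "int n dvd x"
proof -
  have "\<Prod>(exact_pps n) dvd nat \<bar>x\<bar>"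
  proof (rule prod_pairwise_coprime_dvd)
    fix a assume "a \<in> exact_pps n"
    thus "a dvd nat \<bar>x\<bar>" using assms(2) by (simp add: nat_abs_dvd_iff int_dvd_int_iff[symmetric])
  next
    fix a b assume "a \<in> exact_pps n" "b \<in> exact_pps n" "a \<noteq> b"
    then obtain p q where "p \<in> prime_factors n" "q \<in> prime_factors n" "p \<noteq> q"
      and ab: "a = p ^ multiplicity p n" "b = q ^ multiplicity q n"
      unfolding exact_pps_def by blast
    hence "coprime p q" by (intro primes_coprime) (auto simp: in_prime_factors_iff)
    thus "coprime a b" unfolding ab by simp
  qed simp
  hence "n dvd nat \<bar>x\<bar>" using assms(1) by (simp add: prod_exact_pps)
  thus ?thesis by (simp add: int_dvd_int_iff[symmetric])
qed

section \<open>Pruning classes of negligible mass\<close>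

lemma exists_pruned_subset:
  assumes "finite C" "finite W" "\<And>n. n \<in> C \<Longrightarrow> exact_pps n \<subseteq> W" "\<tau> \<ge> 0" "0 \<notin> W"
  obtains D where "D \<subseteq> C" "rsum D \<ge> rsum C - \<tau> * rsum W"
    "\<And>n q. n \<in> D \<Longrightarrow> q \<in> exact_pps n \<Longrightarrow> rsum {m\<in>D. q \<in> exact_pps m} \<ge> \<tau> / real q"
proof -
  \<comment> \<open>Discarding a deficient class from a maximiser of this potential would increase it.\<close>
  define Q where "Q D = (\<Union>n\<in>D. exact_pps n)" for D
  define \<Phi> where "\<Phi> D = rsum D - \<tau> * rsum (Q D)" for D
  have QW: "Q D \<subseteq> W" if "D \<subseteq> C" for D using that assms(3) by (auto simp: Q_def)
  have finQ: "finite (Q D)" if "D \<subseteq> C" for D using QW[OF that] assms(2) finite_subset by blast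
  have "finite (\<Phi> ` Pow C)" "\<Phi> ` Pow C \<noteq> {}" using assms(1) by auto
  hence "Max (\<Phi> ` Pow C) \<in> \<Phi> ` Pow C" by (rule Max_in)
  then obtain D where D: "D \<subseteq> C" and D': "Max (\<Phi> ` Pow C) = \<Phi> D" by auto
  have max: "\<Phi> D' \<le> \<Phi> D" if "D' \<subseteq> C" for D'
    unfolding D'[symmetric] using assms(1) that by (intro Max_ge) auto
  have finD: "finite D" using D assms(1) finite_subset by blast
  show ?thesis
  proof (rule that[OF D])
    have "rsum C - \<tau> * rsum W \<le> \<Phi> C"
      unfolding \<Phi>_def using QW[of C] rsum_mono[OF assms(2), of "Q C"] assms(4) by (simp add: mult_left_mono)
    also have "\<dots> \<le> \<Phi> D" by (rule max) simp
    also have "\<dots> \<le> rsum D" unfolding \<Phi>_def using rsum_nonneg assms(4) by simp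
    finally show "rsum D \<ge> rsum C - \<tau> * rsum W" .
  next
    fix n q assume nq: "n \<in> D" "q \<in> exact_pps n"
    let ?A = "{m\<in>D. q \<in> exact_pps m}"
    show "rsum ?A \<ge> \<tau> / real q"
    proof (rule ccontr)
      assume neg: "\<not> ?thesis"
      hence less: "rsum ?A < \<tau> / real q" by simp
      have "\<tau> \<noteq> 0" using neg rsum_nonneg[of ?A] by auto
      hence \<tau>: "\<tau> > 0" using assms(4) by simp
      have qQ: "q \<in> Q D" using nq by (auto simp: Q_def)
      have "Q (D - ?A) \<subseteq> Q D - {q}" by (auto simp: Q_def)
      hence "rsum (Q (D - ?A)) \<le> rsum (Q D - {q})" using finQ[OF D] by (intro rsum_mono) auto
      also have "\<dots> = rsum (Q D) - 1 / real q" using finQ[OF D] qQ by (subst rsum_Diff) (auto simp: rsum_def)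
      finally have "\<tau> * rsum (Q (D - ?A)) \<le> \<tau> * (rsum (Q D) - 1 / real q)" using \<tau> by simp
      moreover have "rsum (D - ?A) = rsum D - rsum ?A" using finD by (intro rsum_Diff) auto
      ultimately have "\<Phi> (D - ?A) > \<Phi> D" using less by (simp add: \<Phi>_def algebra_simps)
      moreover have "\<Phi> (D - ?A) \<le> \<Phi> D" using D by (intro max) auto
      ultimately show False by simp
    qed
  qed
qed

section \<open>Rankin's trick\<close>

lemma sum_Pow_prod:
  fixes f :: "'a \<Rightarrow> real"
  assumes "finite R"
  shows "(\<Sum>S\<in>Pow R. \<Prod>r\<in>S. f r) = (\<Prod>r\<in>R. 1 + f r)"
  using prod_add[OF assms, of f "\<lambda>_. 1"] by (simp add: add.commute)

lemma sum_Pow_prod_le_exp: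
  assumes "finite R" "c \<ge> 0"
  shows "(\<Sum>S\<in>Pow R. \<Prod>r\<in>S. c / real r) \<le> exp (c * rsum R)"
proof -
  have "(\<Sum>S\<in>Pow R. \<Prod>r\<in>S. c / real r) = (\<Prod>r\<in>R. 1 + c / real r)"
    by (rule sum_Pow_prod[OF assms(1)])
  also have "\<dots> \<le> (\<Prod>r\<in>R. exp (c / real r))"
    using assms by (intro prod_mono) auto
  also have "\<dots> = exp (c * rsum R)"
    using assms by (simp add: exp_sum[symmetric] rsum_def sum_distrib_left)
  finally show ?thesis .
qed

text \<open>The difference of the two multiples is a multiple of \<open>d\<close> of size at most
  \<open>2 * K < d\<close>.\<close>

lemma eq_if_dvd_near:
  fixes x y h d :: int
  assumes "d dvd x" "d dvd y" "\<bar>real_of_int (x - h)\<bar> \<le> K" "\<bar>real_of_int (y - h)\<bar> \<le> K" "2 * K < real_of_int d"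
  shows "x = y"
proof (rule ccontr)
  assume "x \<noteq> y"
  have "d dvd x - y" using assms by (simp add: dvd_diff)
  hence "\<bar>d\<bar> \<le> \<bar>x - y\<bar>" using \<open>x \<noteq> y\<close> by (intro dvd_imp_le_int) auto
  hence "real_of_int d \<le> real_of_int \<bar>x - y\<bar>" by linarith
  thus False using assms by linarith
qed

text \<open>Write \<open>n = q \<cdot> \<Prod>F \<cdot> \<Prod>S\<close>, where \<open>F\<close> and \<open>S\<close> hold the exact prime powers above and
  below \<open>z\<close>. As \<open>q \<cdot> \<Prod>F > 2 K\<close>, the multiple \<open>x\<close> of \<open>n\<close> near \<open>h\<close> depends on \<open>F\<close> only,
  and \<open>S\<close> is confined to the few prime powers dividing \<open>x\<close>. Since \<open>n\<close> has at least \<open>a\<close> exact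
  prime powers, Rankin's trick gains a factor \<open>exp (-a)\<close>.\<close>
lemma rsum_poor_le:
  fixes h :: int
  assumes A: "finite A" and U: "finite U" "0 \<notin> U" and z: "z \<ge> 1"
    and n: "\<And>n. n \<in> A \<Longrightarrow> n > 0 \<and> exact_pps n \<subseteq> U \<and> (q = 1 \<or> q \<in> exact_pps n)
              \<and> a \<le> real (card (exact_pps n)) \<and> 2 * K * z ^ card (exact_pps n) < real n"
    and x: "\<And>n. n \<in> A \<Longrightarrow> \<exists>x. \<bar>real_of_int (x - h)\<bar> \<le> K \<and> int n dvd x \<and> rsum {r\<in>U. int r dvd x} \<le> s"
  shows "rsum A \<le> 1 / real q * exp (1 - a + exp 1 * rsum {r\<in>U. real r > z} + exp 1 * s)"
proof (cases "A = {}")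
  case True
  thus ?thesis by (simp add: rsum_def)
next
  case ne: False
  \<comment> \<open>The choice \<open>q = 1\<close> removes nothing, as 1 is not a prime power. So
    the same argument serves a class with a prescribed exact prime power and a set without
    one.\<close>
  define E where "E n = exact_pps n - {q}" for n
  define F where "F n = {r\<in>E n. real r > z}" for n
  define S where "S n = {r\<in>E n. real r \<le> z}" for n
  define g where "g T = (\<Prod>r\<in>T. exp 1 / real r)" for T :: "nat set"
  obtain X where X: "\<And>n. n \<in> A \<Longrightarrow> \<bar>real_of_int (X n - h)\<bar> \<le> K \<and> int n dvd X n \<and> rsum {r\<in>U. int r dvd X n} \<le> s"
    using x by metis
  have q0: "q > 0" using ne n exact_pps_pos by (metis all_not_in_conv less_one)
  have finE: "finite (E n)" "finite (F n)" "finite (S n)" for n by (auto simp: E_def F_def S_def)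
  have EFS: "E n = F n \<union> S n" "F n \<inter> S n = {}" for n by (auto simp: F_def S_def)
  have nq: "n = q * \<Prod>(E n)" if "n \<in> A" for n
  proof (cases "q \<in> exact_pps n")
    case True
    thus ?thesis using prod_exact_pps[of n] n[OF that] by (simp add: E_def prod.remove[of _ q])
  next
    case False
    hence "q = 1" "E n = exact_pps n" using n[OF that] by (auto simp: E_def)
    thus ?thesis using prod_exact_pps[of n] n[OF that] by simp
  qed
  have nFS: "n = q * \<Prod>(F n) * \<Prod>(S n)" if "n \<in> A" for n
    using nq[OF that] prod.union_disjoint[OF finE(2,3) EFS(2), of "\<lambda>x. x" n] EFS(1)[of n] by simp
  have cardE: "a - 1 \<le> real (card (E n))" if "n \<in> A" for n
    using n[OF that] card_Diff_singleton_if[of "exact_pps n" q] by (auto simp: E_def split: if_splits)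
  \<comment> \<open>Every element of \<open>S n\<close> is at most \<open>z\<close>, so dividing
    \<open>n\<close> by \<open>\<Prod>(S n)\<close> costs at most the factor
    \<open>z ^ card (exact_pps n)\<close>.\<close>
  have big: "2 * K < real (q * \<Prod>(F n))" if "n \<in> A" for n
  proof -
    have "real (\<Prod>(S n)) = (\<Prod>r\<in>S n. real r)" by simp
    also have "\<dots> \<le> (\<Prod>r\<in>S n. z)" by (intro prod_mono) (auto simp: S_def)
    also have "\<dots> = z ^ card (S n)" by simp
    also have "\<dots> \<le> z ^ card (exact_pps n)"
      using z by (intro power_increasing card_mono) (auto simp: S_def E_def)
    finally have Sz: "real (\<Prod>(S n)) \<le> z ^ card (exact_pps n)" .
    have "2 * K * z ^ card (exact_pps n) < real (q * \<Prod>(F n)) * real (\<Prod>(S n))"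
      using n[OF that] nFS[OF that] by (metis of_nat_mult)
    also have "\<dots> \<le> real (q * \<Prod>(F n)) * z ^ card (exact_pps n)"
      using Sz by (intro mult_left_mono) (auto intro!: mult_nonneg_nonneg prod_nonneg)
    finally show ?thesis using z by (simp add: mult_less_cancel_right)
  qed
  have XF: "X n = X m" if "n \<in> A" "m \<in> A" "F n = F m" for n m
  proof (rule eq_if_dvd_near)
    have "q * \<Prod>(F n) dvd n" "q * \<Prod>(F m) dvd m" using nFS that by (metis dvd_triv_left)+
    thus "int (q * \<Prod>(F n)) dvd X n" "int (q * \<Prod>(F n)) dvd X m"
      using X that by (metis dvd_trans int_dvd_int_iff)+
    show "2 * K < real_of_int (int (q * \<Prod>(F n)))" using big[OF that(1)] by simp
  qed (use X that in auto)
  \<comment> \<open>By \<open>XF\<close> the choice of the representative does not affect the nearby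
    multiple, so \<open>R T\<close> depends on \<open>T\<close> alone.\<close>
  define R where "R T = {r\<in>U. int r dvd X (SOME n. n \<in> A \<and> F n = T)}" for T
  have R: "R (F n) = {r\<in>U. int r dvd X n}" if "n \<in> A" for n
  proof -
    have "(SOME m. m \<in> A \<and> F m = F n) \<in> A \<and> F (SOME m. m \<in> A \<and> F m = F n) = F n"
      by (rule someI[of _ n]) (use that in auto)
    thus ?thesis unfolding R_def using XF that by metis
  qed
  have SR: "S n \<subseteq> R (F n)" if "n \<in> A" for n
  proof
    fix r assume "r \<in> S n"
    hence "r \<in> exact_pps n" by (auto simp: S_def E_def)
    hence "r \<in> U" "r dvd n" using n[OF that] exact_pps_dvd by auto
    moreover have "int r dvd X n" using \<open>r dvd n\<close> X[OF that] dvd_trans[of "int r" "int n" "X n"] by simp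
    ultimately show "r \<in> R (F n)" unfolding R[OF that] by simp
  qed
  \<comment> \<open>Each prime power other than \<open>q\<close> gets the weight
    \<open>exp 1\<close>. At least \<open>a - 1\<close> of them remain once \<open>q\<close> is
    removed, so the factor \<open>exp (1 - a)\<close> is more than repaid.\<close>
  define c where "c = 1 / real q * exp (1 - a)"
  have summand: "1 / real n \<le> c * (g (F n) * g (S n))" if "n \<in> A" for n
  proof -
    have "g (F n) * g (S n) = g (E n)"
      unfolding g_def EFS(1)[of n] by (rule prod.union_disjoint[symmetric]) (use finE EFS in auto)
    also have "\<dots> = exp (real (card (E n))) * (1 / real (\<Prod>(E n)))"
      using exp_of_nat_mult[of "card (E n)" "1::real"] by (simp add: g_def prod_dividef)
    finally have "c * (g (F n) * g (S n)) = exp (1 - a + real (card (E n))) * (1 / (real q * real (\<Prod>(E n))))"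
      by (simp add: c_def exp_add)
    also have "real q * real (\<Prod>(E n)) = real n" using nq[OF that] by (metis of_nat_mult)
    also have "exp (1 - a + real (card (E n))) * (1 / real n) \<ge> 1 * (1 / real n)"
      using cardE[OF that] by (intro mult_right_mono) auto
    finally show ?thesis by simp
  qed
  have inj: "inj_on (\<lambda>n. (F n, S n)) A"
    by (rule inj_onI) (metis nFS prod.inject)
  have gpos: "g T \<ge> 0" for T unfolding g_def by (intro prod_nonneg) auto
  have finR: "finite (R T)" for T using U by (simp add: R_def)
  have "rsum A \<le> (\<Sum>n\<in>A. c * (g (F n) * g (S n)))"
    unfolding rsum_def by (intro sum_mono summand)
  also have "\<dots> = c * (\<Sum>(T, S)\<in>(\<lambda>n. (F n, S n)) ` A. g T * g S)"
    by (subst sum.reindex[OF inj]) (simp add: sum_distrib_left)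
  \<comment> \<open>Overcounting: \<open>S\<close> may now be any subset of \<open>R T\<close>,
    whether or not the pair comes from an element of \<open>A\<close>.\<close>
  also have "\<dots> \<le> c * (\<Sum>(T, S)\<in>Sigma (F ` A) (\<lambda>T. Pow (R T)). g T * g S)"
    using SR A finR gpos by (intro mult_left_mono sum_mono2) (auto simp: c_def)
  also have "\<dots> = c * (\<Sum>T\<in>F ` A. g T * (\<Sum>S\<in>Pow (R T). g S))"
    using A finR by (subst sum.Sigma[symmetric]) (auto simp: sum_distrib_left)
  also have "\<dots> \<le> c * (\<Sum>T\<in>F ` A. g T * exp (exp 1 * s))"
  proof (intro mult_left_mono sum_mono gpos)
    fix T assume "T \<in> F ` A"
    then obtain n where nA: "n \<in> A" "T = F n" by blast
    have "(\<Sum>S\<in>Pow (R T). g S) \<le> exp (exp 1 * rsum (R T))"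
      unfolding g_def by (rule sum_Pow_prod_le_exp) (use finR in auto)
    also have "\<dots> \<le> exp (exp 1 * s)" using X[OF nA(1)] R[OF nA(1)] nA by simp
    finally show "(\<Sum>S\<in>Pow (R T). g S) \<le> exp (exp 1 * s)" .
  qed (auto simp: c_def)
  also have "\<dots> = c * exp (exp 1 * s) * (\<Sum>T\<in>F ` A. g T)"
    by (simp add: sum_distrib_right mult_ac)
  also have "\<dots> \<le> c * exp (exp 1 * s) * (\<Sum>T\<in>Pow {r\<in>U. real r > z}. g T)"
  proof (intro mult_left_mono sum_mono2 gpos)
    show "F ` A \<subseteq> Pow {r \<in> U. z < real r}" using n by (fastforce simp: F_def E_def)
  qed (use U in \<open>auto simp: c_def\<close>)
  also have "\<dots> \<le> c * exp (exp 1 * s) * exp (exp 1 * rsum {r\<in>U. real r > z})"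
    unfolding g_def by (intro mult_left_mono sum_Pow_prod_le_exp) (use U in \<open>auto simp: c_def\<close>)
  also have "\<dots> = 1 / real q * exp (1 - a + exp 1 * rsum {r\<in>U. real r > z} + exp 1 * s)"
    by (simp add: c_def exp_add mult_ac)
  finally show ?thesis .
qed

section \<open>The Fourier argument\<close>

lemma abs_sin_diff_le: "\<bar>sin x - x\<bar> \<le> \<bar>x\<bar> ^ 3 / 6" for x :: real
  using Maclaurin_sin_bound[of x 3] by (simp add: eval_nat_numeral sin_coeff_def lessThan_Suc)

lemma one_minus_cos_le: "1 - cos x \<le> x\<^sup>2 / 2" for x :: real
proof -
  have "1 - cos x = 2 * (sin (x / 2))\<^sup>2"
    using cos_double_sin[of "x / 2"] by simp
  also have "(sin (x / 2))\<^sup>2 \<le> (x / 2)\<^sup>2"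
    using abs_sin_x_le_abs_x[of "x / 2"] by (simp only: abs_le_square_iff)
  finally show ?thesis by (simp add: power2_eq_square)
qed

text \<open>With \<open>x = pi * \<bar>v\<bar> <= 8 / 5\<close> one has \<open>x^2 <= 3\<close>, so
  the cubic Taylor error leaves \<open>sin x >= x / 2 >= \<bar>v\<bar>\<close>; then
  \<open>1 - cos (2 * x)\<close> is twice the square of \<open>sin x\<close>.\<close>

lemma one_minus_cos_2pi_ge:
  fixes v :: real
  assumes "\<bar>v\<bar> \<le> 1 / 2"
  shows "1 - cos (2 * pi * v) \<ge> 2 * v\<^sup>2"
proof -
  define x where "x = pi * \<bar>v\<bar>"
  have x: "0 \<le> x" "x \<le> pi / 2" using assms by (auto simp: x_def)
  moreover have "pi \<le> 16 / 5" using pi_approx by simp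
  ultimately have "x \<le> 8 / 5" by linarith
  hence "x\<^sup>2 \<le> (8 / 5)\<^sup>2" using x by (intro power_mono) auto
  hence "x * x\<^sup>2 \<le> x * (8 / 5)\<^sup>2" using x by (intro mult_left_mono) auto
  hence "x ^ 3 / 6 \<le> x / 2" using x by (simp add: power2_eq_square power3_eq_cube)
  hence "x / 2 \<le> sin x" using abs_sin_diff_le[of x] x by (simp only: abs_of_nonneg)
  moreover have "\<bar>v\<bar> \<le> x / 2" using pi_gt3 mult_right_mono[of 2 pi "\<bar>v\<bar>"] by (simp add: x_def)
  ultimately have "\<bar>v\<bar>\<^sup>2 \<le> (sin x)\<^sup>2" by (intro power_mono) auto
  moreover have "cos (2 * pi * v) = cos (2 * x)" by (cases "v \<ge> 0") (auto simp: x_def abs_if mult_ac)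
  ultimately show ?thesis using cos_double_sin[of x] by simp
qed

lemma cis_2pi_diff_int: "cis (2 * pi * (t - of_int m)) = cis (2 * pi * t)"
  by (simp add: right_diff_distrib cis_divide[symmetric] cis_multiple_2pi)

text \<open>The squared modulus is \<open>1 - 2 * p * (1 - p) * (1 - cos y)\<close>. Since
  \<open>p <= 1 / 2\<close>, the factor \<open>2 * (1 - p)\<close> is at least 1, and the quadratic
  lower bound for \<open>1 - cos\<close> applies after reducing \<open>t\<close> modulo 1.\<close>

lemma norm_bernoulli_cis_le:
  fixes p t :: real and m :: int
  assumes p: "0 \<le> p" "p \<le> 1 / 2" and m: "\<bar>t - of_int m\<bar> \<le> 1 / 2"
  shows "norm (1 - of_real p + of_real p * cis (2 * pi * t)) \<le> exp (- p * (t - of_int m)\<^sup>2)"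
proof -
  define v where "v = t - of_int m"
  define y where "y = 2 * pi * v"
  have cis: "cis (2 * pi * t) = cis y" unfolding y_def v_def by (rule cis_2pi_diff_int[symmetric])
  have "(norm (1 - of_real p + of_real p * cis y))\<^sup>2 = (1 - p + p * cos y)\<^sup>2 + (p * sin y)\<^sup>2"
    by (simp add: cmod_power2)
  also have "\<dots> = 1 - 2 * p * (1 - p) * (1 - cos y)"
  proof -
    have "(p * sin y)\<^sup>2 = p\<^sup>2 * (1 - (cos y)\<^sup>2)"
      by (simp only: power_mult_distrib sin_squared_eq)
    thus ?thesis by (simp add: power2_eq_square algebra_simps)
  qed
  also have "\<dots> \<le> 1 - 2 * p * v\<^sup>2"
  proof -
    have "p * v\<^sup>2 \<le> p * (2 * (1 - p) * v\<^sup>2)" using p by (intro mult_left_mono) (auto simp: mult_right_mono[of 1 "2 * (1 - p)" "v\<^sup>2", simplified])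
    also have "\<dots> = p * (1 - p) * (2 * v\<^sup>2)" by simp
    also have "\<dots> \<le> p * (1 - p) * (1 - cos y)"
      using p one_minus_cos_2pi_ge[of v] m unfolding y_def v_def by (intro mult_left_mono) auto
    finally show ?thesis by simp
  qed
  also have "\<dots> \<le> exp (- 2 * p * v\<^sup>2)" using exp_ge_add_one_self[of "- 2 * p * v\<^sup>2"] by simp
  also have "\<dots> = (exp (- p * v\<^sup>2))\<^sup>2" by (simp add: exp_double[symmetric])
  finally show ?thesis unfolding cis v_def by (rule power2_le_imp_le) simp
qed

text \<open>After the positive real parts are factored out, a product of terms
  \<open>1 + \<i> * t n\<close> remains. It lies within \<open>exp (1 / 2) - 1 <= 1\<close> of 1,
  hence in the right half-plane.\<close>

lemma Re_prod_nonneg: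
  fixes z :: "nat \<Rightarrow> complex"
  assumes "finite A" "\<And>n. n \<in> A \<Longrightarrow> Re (z n) > 0" "(\<Sum>n\<in>A. \<bar>Im (z n)\<bar> / Re (z n)) \<le> 1 / 2"
  shows "Re (\<Prod>n\<in>A. z n) \<ge> 0"
proof -
  define t where "t n = Im (z n) / Re (z n)" for n
  define w where "w = (\<Prod>n\<in>A. 1 + \<i> * of_real (t n))"
  have "(\<Prod>n\<in>A. z n) = (\<Prod>n\<in>A. of_real (Re (z n)) * (1 + \<i> * of_real (t n)))"
  proof (rule prod.cong)
    fix n assume "n \<in> A"
    hence "Re (z n) \<noteq> 0" using assms(2) by force
    thus "z n = of_real (Re (z n)) * (1 + \<i> * of_real (t n))" by (simp add: complex_eq_iff t_def)
  qed simp
  also have "\<dots> = of_real (\<Prod>n\<in>A. Re (z n)) * w" by (simp add: prod.distrib w_def)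
  finally have *: "Re (\<Prod>n\<in>A. z n) = (\<Prod>n\<in>A. Re (z n)) * Re w"
    by (simp add: of_real_prod[symmetric] del: of_real_prod)
  have "norm (w - 1) \<le> (\<Prod>n\<in>A. 1 + norm (\<i> * of_real (t n))) - 1"
    unfolding w_def by (rule norm_prod_minus1_le_prod_minus1)
  also have "(\<Prod>n\<in>A. 1 + norm (\<i> * of_real (t n))) \<le> (\<Prod>n\<in>A. exp \<bar>t n\<bar>)"
    by (intro prod_mono) (auto simp: norm_mult)
  also have "\<dots> = exp (\<Sum>n\<in>A. \<bar>t n\<bar>)" using assms(1) by (simp add: exp_sum)
  also have "(\<Sum>n\<in>A. \<bar>t n\<bar>) = (\<Sum>n\<in>A. \<bar>Im (z n)\<bar> / Re (z n))"
    using assms(2) by (intro sum.cong) (auto simp: t_def abs_of_pos)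
  also have "exp \<dots> \<le> exp (1 / 2)" using assms(3) by simp
  also have "exp (1 / 2 :: real) \<le> 2" using exp_half_le2 by simp
  finally have "norm (w - 1) \<le> 1" by simp
  hence "Re w \<ge> 0" using abs_Re_le_cmod[of "w - 1"] by simp
  thus ?thesis unfolding * using assms(2) by (intro mult_nonneg_nonneg prod_nonneg) (auto intro: less_imp_le)
qed

text \<open>The factor \<open>cis (- p * y)\<close> centres the Bernoulli variable: the linear terms
  of the imaginary part, \<open>p * (1 - p) * y\<close> and \<open>(1 - p) * p * y\<close>, cancel,
  and only the cubic errors of \<open>sin\<close> survive.\<close>

lemma bernoulli_cis_phase:
  fixes p y :: real
  assumes p: "0 \<le> p" "p \<le> 1" and y: "\<bar>y\<bar> \<le> 1"
  defines "z \<equiv> cis (- p * y) * (1 - of_real p + of_real p * cis y)"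
  shows "Re z \<ge> 1 / 2" "\<bar>Im z\<bar> / Re z \<le> \<bar>y\<bar> ^ 3"
proof -
  have z: "z = of_real (1 - p) * cis (- p * y) + of_real p * cis ((1 - p) * y)"
    by (simp add: z_def cis_mult algebra_simps)
  have sq: "(s * y)\<^sup>2 \<le> 1" if "0 \<le> s" "s \<le> 1" for s
    using that y by (simp add: power_mult_distrib power_le_one mult_le_one abs_square_le_1)
  have cb: "cos (- p * y) \<ge> 1 / 2" "cos ((1 - p) * y) \<ge> 1 / 2"
    using one_minus_cos_le[of "p * y"] one_minus_cos_le[of "(1 - p) * y"] sq[of p] sq[of "1 - p"] p by auto
  have "Re z = (1 - p) * cos (- p * y) + p * cos ((1 - p) * y)" by (simp add: z)
  also have "\<dots> \<ge> (1 - p) * (1 / 2) + p * (1 / 2)" using cb p by (intro add_mono mult_left_mono) auto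
  finally show re: "Re z \<ge> 1 / 2" by (simp add: field_simps)
  define d where "d x = sin x - x" for x :: real
  have db: "\<bar>d (s * y)\<bar> \<le> \<bar>y\<bar> ^ 3 / 6" if "0 \<le> s" "s \<le> 1" for s
  proof -
    have "\<bar>d (s * y)\<bar> \<le> \<bar>s * y\<bar> ^ 3 / 6" unfolding d_def by (rule abs_sin_diff_le)
    also have "\<bar>s * y\<bar> ^ 3 \<le> \<bar>y\<bar> ^ 3"
      using that by (intro power_mono) (simp_all add: abs_mult mult_left_le_one_le)
    finally show ?thesis by simp
  qed
  have "Im z = p * d ((1 - p) * y) - (1 - p) * d (p * y)" by (simp add: z d_def algebra_simps)
  hence "\<bar>Im z\<bar> \<le> p * \<bar>d ((1 - p) * y)\<bar> + (1 - p) * \<bar>d (p * y)\<bar>"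
    using p abs_triangle_ineq4[of "p * d ((1 - p) * y)" "(1 - p) * d (p * y)"] by (simp add: abs_mult)
  also have "\<dots> \<le> p * (\<bar>y\<bar> ^ 3 / 6) + (1 - p) * (\<bar>y\<bar> ^ 3 / 6)"
    using p by (intro add_mono mult_left_mono db) auto
  also have "\<dots> = \<bar>y\<bar> ^ 3 / 6" by (simp only: distrib_right[symmetric]) simp
  finally have "\<bar>Im z\<bar> \<le> \<bar>y\<bar> ^ 3 / 6" .
  moreover have "\<bar>y\<bar> ^ 3 * (1 / 2) \<le> \<bar>y\<bar> ^ 3 * Re z" using re by (intro mult_left_mono) auto
  moreover have "\<bar>y\<bar> ^ 3 \<ge> 0" by simp
  ultimately have "\<bar>Im z\<bar> \<le> \<bar>y\<bar> ^ 3 * Re z" by linarith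
  thus "\<bar>Im z\<bar> / Re z \<le> \<bar>y\<bar> ^ 3" using re by (simp add: divide_le_eq)
qed

section \<open>Fourier inversion modulo a common multiple\<close>

lemma sum_cis_multiples:
  fixes t :: real
  assumes "real P * t \<in> \<int>"
  shows "(\<Sum>h<P. cis (2 * pi * real h * t)) = (if t \<in> \<int> then of_nat P else 0)"
proof -
  define \<omega> where "\<omega> = cis (2 * pi * t)"
  have pow: "cis (2 * pi * real h * t) = \<omega> ^ h" for h by (simp add: \<omega>_def Complex.DeMoivre mult_ac)
  show ?thesis
  proof (cases "t \<in> \<int>")
    case True
    hence "\<omega> = 1" by (simp add: \<omega>_def cis_multiple_2pi)
    thus ?thesis using True by (simp add: pow)
  next
    case False
    have "\<omega> \<noteq> 1"
    proof
      assume "\<omega> = 1"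
      hence "cos (2 * pi * t) = 1" by (metis \<omega>_def cis.sel(1) one_complex.sel(1))
      then obtain i :: int where "2 * pi * t = of_int i * 2 * pi" by (auto simp: cos_one_2pi_int)
      hence "t = of_int i" by simp
      thus False using False by simp
    qed
    moreover have "\<omega> ^ P = 1" using assms cis_multiple_2pi[of "real P * t"] by (simp add: pow[symmetric] mult.assoc)
    ultimately show ?thesis using False by (simp add: pow sum_gp_strict)
  qed
qed

text \<open>For \<open>S \<subseteq> D\<close> this is the probability that the random subset equals
  \<open>S\<close>.\<close>

definition bernoulli_weight :: "real \<Rightarrow> nat set \<Rightarrow> nat set \<Rightarrow> real" where
  "bernoulli_weight p D S = p ^ card S * (1 - p) ^ card (D - S)"

text \<open>The characteristic function at \<open>2 \<pi> h\<close> of a random subset sum, each \<open>n \<in> D\<close> being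
  chosen independently with probability \<open>p\<close>.\<close>
definition char_prod :: "real \<Rightarrow> nat set \<Rightarrow> int \<Rightarrow> complex" where
  "char_prod p D h = (\<Prod>n\<in>D. 1 - of_real p + of_real p * cis (2 * pi * (of_int h / real n)))"

lemma bernoulli_weight_nonneg: "0 \<le> p \<Longrightarrow> p \<le> 1 \<Longrightarrow> bernoulli_weight p D S \<ge> 0"
  by (simp add: bernoulli_weight_def)

lemma prod_cis: "finite A \<Longrightarrow> (\<Prod>n\<in>A. cis (f n)) = cis (\<Sum>n\<in>A. f n)"
  by (induction A rule: finite_induct) (auto simp: cis_mult)

lemma char_prod_expand:
  assumes "finite D"
  shows "char_prod p D h =
    (\<Sum>S\<in>Pow D. of_real (bernoulli_weight p D S) * cis (2 * pi * of_int h * rsum S))"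
proof -
  have "char_prod p D h = (\<Prod>n\<in>D. of_real p * cis (2 * pi * (of_int h / real n)) + of_real (1 - p))"
    by (simp add: char_prod_def add.commute)
  also have "\<dots> = (\<Sum>S\<in>Pow D. (\<Prod>n\<in>S. of_real p * cis (2 * pi * (of_int h / real n))) *
                       (\<Prod>n\<in>D - S. of_real (1 - p)))"
    by (rule prod_add[OF assms])
  also have "\<dots> = (\<Sum>S\<in>Pow D. of_real (bernoulli_weight p D S) * cis (2 * pi * of_int h * rsum S))"
  proof (rule sum.cong)
    fix S assume "S \<in> Pow D"
    hence "finite S" using assms finite_subset by auto
    hence "(\<Prod>n\<in>S. cis (2 * pi * (of_int h / real n))) = cis (2 * pi * of_int h * rsum S)"
      by (simp add: prod_cis rsum_def sum_distrib_left)
    thus "(\<Prod>n\<in>S. of_real p * cis (2 * pi * (of_int h / real n))) * (\<Prod>n\<in>D - S. of_real (1 - p))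
        = of_real (bernoulli_weight p D S) * cis (2 * pi * of_int h * rsum S)"
      by (simp add: prod.distrib bernoulli_weight_def)
  qed simp
  finally show ?thesis .
qed

lemma rsum_times_common_multiple_Ints:
  assumes "\<And>n. n \<in> S \<Longrightarrow> n dvd P" "0 \<notin> S"
  shows "real P * rsum S \<in> \<int>"
proof -
  have "real P * (1 / real n) \<in> \<int>" if n: "n \<in> S" for n
  proof -
    obtain k where "P = n * k" using assms(1)[OF n] by blast
    moreover have "n \<noteq> 0" using n assms(2) by metis
    ultimately show ?thesis by simp
  qed
  thus ?thesis unfolding rsum_def sum_distrib_left by (rule Ints_sum)
qed

text \<open>All subset sums are multiples of \<open>1 / P\<close>, so orthogonality of the
  characters modulo \<open>P\<close> picks out the integral ones.\<close>

lemma sum_char_prod: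
  assumes "finite D" "\<And>n. n \<in> D \<Longrightarrow> n dvd P" "0 \<notin> D"
  shows "(\<Sum>h<P. char_prod p D (int h)) =
    of_real (real P * (\<Sum>S | S \<subseteq> D \<and> rsum S \<in> \<int>. bernoulli_weight p D S))"
proof -
  have "(\<Sum>h<P. char_prod p D (int h)) =
      (\<Sum>S\<in>Pow D. of_real (bernoulli_weight p D S) * (\<Sum>h<P. cis (2 * pi * real h * rsum S)))"
    unfolding char_prod_expand[OF assms(1)] by (subst sum.swap) (simp add: sum_distrib_left)
  also have "\<dots> = (\<Sum>S\<in>Pow D. if rsum S \<in> \<int> then of_real (real P * bernoulli_weight p D S) else 0)"
  proof (rule sum.cong)
    fix S assume "S \<in> Pow D"
    hence "real P * rsum S \<in> \<int>" using assms by (intro rsum_times_common_multiple_Ints) auto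
    thus "of_real (bernoulli_weight p D S) * (\<Sum>h<P. cis (2 * pi * real h * rsum S)) =
      (if rsum S \<in> \<int> then of_real (real P * bernoulli_weight p D S) else (0::complex))"
      by (simp add: sum_cis_multiples)
  qed simp
  also have "\<dots> = (\<Sum>S | S \<in> Pow D \<and> rsum S \<in> \<int>. of_real (real P * bernoulli_weight p D S))"
    using assms(1) by (intro sum.inter_filter[symmetric]) simp
  finally show ?thesis by (simp add: sum_distrib_left)
qed

lemma norm_char_prod_le:
  assumes "finite D" "0 \<le> p" "p \<le> 1 / 2"
    and "\<And>n. n \<in> D \<Longrightarrow> \<exists>m::int. \<bar>of_int h / real n - of_int m\<bar> \<le> 1 / 2 \<and> u n \<le> (of_int h / real n - of_int m)\<^sup>2"
  shows "norm (char_prod p D h) \<le> exp (- p * (\<Sum>n\<in>D. u n))"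
proof -
  have "norm (char_prod p D h) = (\<Prod>n\<in>D. norm (1 - of_real p + of_real p * cis (2 * pi * (of_int h / real n))))"
    by (simp add: char_prod_def prod_norm)
  also have "\<dots> \<le> (\<Prod>n\<in>D. exp (- p * u n))"
  proof (rule prod_mono, intro conjI)
    fix n assume "n \<in> D"
    then obtain m :: int where m: "\<bar>of_int h / real n - of_int m\<bar> \<le> 1 / 2" "u n \<le> (of_int h / real n - of_int m)\<^sup>2"
      using assms(4) by blast
    have "norm (1 - of_real p + of_real p * cis (2 * pi * (of_int h / real n)))
        \<le> exp (- p * (of_int h / real n - of_int m)\<^sup>2)"
      by (rule norm_bernoulli_cis_le[OF assms(2,3) m(1)])
    also have "\<dots> \<le> exp (- p * u n)" using m(2) assms(2) by (simp add: mult_left_mono)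
    finally show "norm (1 - of_real p + of_real p * cis (2 * pi * (of_int h / real n))) \<le> exp (- p * u n)" .
  qed simp
  also have "\<dots> = exp (- p * (\<Sum>n\<in>D. u n))" using assms(1) by (simp add: exp_sum[symmetric] sum_distrib_left sum_negf)
  finally show ?thesis .
qed

text \<open>Shifting by \<open>P\<close> leaves every phase unchanged modulo full turns. So
  frequencies just below \<open>P\<close> behave like small ones.\<close>

lemma char_prod_reflect:
  assumes "\<And>n. n \<in> D \<Longrightarrow> n dvd P" "0 \<notin> D"
  shows "char_prod p D (int P - h) = cnj (char_prod p D h)"
proof -
  have "cis (2 * pi * (of_int (int P - h) / real n)) = cnj (cis (2 * pi * (of_int h / real n)))" if n: "n \<in> D" for n
  proof -
    obtain k where k: "P = n * k" using assms(1)[OF n] by blast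
    have "n \<noteq> 0" using n assms(2) by metis
    hence "of_int (int P - h) / real n = - (of_int h / real n) - of_int (- int k)"
      by (simp add: k field_simps)
    hence "cis (2 * pi * (of_int (int P - h) / real n)) = cis (2 * pi * (- (of_int h / real n)))"
      by (simp only: cis_2pi_diff_int)
    thus ?thesis by (simp add: cis_cnj)
  qed
  thus ?thesis by (simp add: char_prod_def)
qed

text \<open>Because the mean \<open>p * rsum D\<close> is 1, the mean phases add up to
  \<open>2 * pi * h\<close>, a whole number of turns. Centring every factor therefore does not
  change the product, and the centred factors are nearly real.\<close>

lemma Re_char_prod_nonneg:
  fixes h :: int
  assumes D: "finite D" "0 \<notin> D" and p: "0 \<le> p" "p \<le> 1" "p * rsum D = 1"
    and small: "\<And>n. n \<in> D \<Longrightarrow> \<bar>2 * pi * (of_int h / real n)\<bar> \<le> 1"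
    and cubes: "(\<Sum>n\<in>D. \<bar>2 * pi * (of_int h / real n)\<bar> ^ 3) \<le> 1 / 2"
  shows "Re (char_prod p D h) \<ge> 0"
proof -
  define y where "y n = 2 * pi * (of_int h / real n)" for n :: nat
  define z where "z n = cis (- p * y n) * (1 - of_real p + of_real p * cis (y n))" for n
  have "(\<Sum>n\<in>D. - p * y n) = - 2 * pi * of_int h * (p * rsum D)"
    by (simp add: y_def rsum_def sum_distrib_left sum_negf mult_ac)
  also have "\<dots> = - (2 * pi * of_int h)" by (simp add: p(3))
  finally have "(\<Prod>n\<in>D. cis (- p * y n)) = cnj (cis (2 * pi * of_int h))"
    by (simp only: prod_cis[OF D(1)] cis_cnj)
  hence "(\<Prod>n\<in>D. cis (- p * y n)) = 1" by simp
  hence "char_prod p D h = (\<Prod>n\<in>D. z n)"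
    by (simp add: z_def prod.distrib char_prod_def y_def)
  moreover have "Re (\<Prod>n\<in>D. z n) \<ge> 0"
  proof (rule Re_prod_nonneg[OF D(1)])
    fix n assume "n \<in> D"
    thus "Re (z n) > 0" using bernoulli_cis_phase(1)[OF p(1,2), of "y n"] small by (force simp: z_def y_def)
  next
    have "(\<Sum>n\<in>D. \<bar>Im (z n)\<bar> / Re (z n)) \<le> (\<Sum>n\<in>D. \<bar>y n\<bar> ^ 3)"
      unfolding z_def by (intro sum_mono bernoulli_cis_phase p) (use small in \<open>auto simp: y_def\<close>)
    thus "(\<Sum>n\<in>D. \<bar>Im (z n)\<bar> / Re (z n)) \<le> 1 / 2" using cubes by (simp add: y_def)
  qed
  ultimately show ?thesis by simp
qed

text \<open>Chernoff's bound with exponential parameter \<open>N / 2\<close>. As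
  \<open>n >= N\<close>, each exponent \<open>u = N / 2 / n\<close> is at most \<open>1 / 2\<close>,
  where \<open>exp u <= 1 + 3 / 2 * u\<close>; mean 1 then gives
  \<open>exp (- N + 3 / 4 * N)\<close>.\<close>

lemma bernoulli_weight_upper_tail:
  fixes N :: real
  assumes D: "finite D" and N: "N > 0" "\<And>n. n \<in> D \<Longrightarrow> N \<le> real n"
    and p: "0 \<le> p" "p \<le> 1" "p * rsum D = 1"
  shows "(\<Sum>S | S \<subseteq> D \<and> rsum S \<ge> 2. bernoulli_weight p D S) \<le> exp (- N / 4)"
proof -
  have "(\<Sum>S | S \<subseteq> D \<and> rsum S \<ge> 2. bernoulli_weight p D S)
      \<le> (\<Sum>S | S \<subseteq> D \<and> rsum S \<ge> 2. bernoulli_weight p D S * exp (N / 2 * rsum S - N))"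
  proof (rule sum_mono)
    fix S assume "S \<in> {S. S \<subseteq> D \<and> rsum S \<ge> 2}"
    hence "N / 2 * 2 \<le> N / 2 * rsum S" using N by (intro mult_left_mono) auto
    hence "bernoulli_weight p D S * 1 \<le> bernoulli_weight p D S * exp (N / 2 * rsum S - N)"
      using bernoulli_weight_nonneg[OF p(1,2)] by (intro mult_left_mono) auto
    thus "bernoulli_weight p D S \<le> bernoulli_weight p D S * exp (N / 2 * rsum S - N)" by simp
  qed
  also have "\<dots> \<le> (\<Sum>S\<in>Pow D. bernoulli_weight p D S * exp (N / 2 * rsum S - N))"
    using D bernoulli_weight_nonneg[OF p(1,2)] by (intro sum_mono2) auto
  also have "\<dots> = (\<Sum>S\<in>Pow D. exp (- N) * (bernoulli_weight p D S * exp (N / 2 * rsum S)))"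
    by (intro sum.cong refl) (simp only: mult.left_commute[of "exp (- N)"] exp_add[symmetric], simp)
  also have "\<dots> = exp (- N) * (\<Sum>S\<in>Pow D. bernoulli_weight p D S * exp (N / 2 * rsum S))"
    by (simp only: sum_distrib_left)
  also have "(\<Sum>S\<in>Pow D. bernoulli_weight p D S * exp (N / 2 * rsum S)) =
      (\<Sum>S\<in>Pow D. (\<Prod>n\<in>S. p * exp (N / 2 / real n)) * (\<Prod>n\<in>D - S. 1 - p))"
  proof (rule sum.cong)
    fix S assume "S \<in> Pow D"
    hence "finite S" using D finite_subset by auto
    hence "exp (N / 2 * rsum S) = (\<Prod>n\<in>S. exp (N / 2 / real n))"
      by (simp add: exp_sum[symmetric] rsum_def sum_distrib_left)
    thus "bernoulli_weight p D S * exp (N / 2 * rsum S) = (\<Prod>n\<in>S. p * exp (N / 2 / real n)) * (\<Prod>n\<in>D - S. 1 - p)"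
      by (simp add: prod.distrib bernoulli_weight_def)
  qed simp
  also have "\<dots> = (\<Prod>n\<in>D. p * exp (N / 2 / real n) + (1 - p))" by (rule prod_add[OF D, symmetric])
  also have "\<dots> \<le> (\<Prod>n\<in>D. exp (3 / 4 * N * (p * (1 / real n))))"
  proof (rule prod_mono, intro conjI)
    fix n assume "n \<in> D"
    hence nN: "N \<le> real n" by (rule N(2))
    define u where "u = N / 2 / real n"
    have u: "0 \<le> u" "u \<le> 1 / 2" using nN N(1) by (auto simp: u_def divide_simps)
    have "u\<^sup>2 \<le> u * (1 / 2)" unfolding power2_eq_square using u by (intro mult_left_mono) auto
    moreover have "exp u \<le> 1 + u + u\<^sup>2" using u by (intro exp_bound) auto
    ultimately have "exp u \<le> 1 + 3 / 2 * u" by linarith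
    hence "p * exp u + (1 - p) \<le> p * (1 + 3 / 2 * u) + (1 - p)" using p by (simp add: mult_left_mono)
    also have "\<dots> = 1 + 3 / 2 * u * p" by (simp add: algebra_simps)
    also have "\<dots> \<le> exp (3 / 2 * u * p)" by (rule exp_ge_add_one_self)
    also have "3 / 2 * u * p = 3 / 4 * N * (p * (1 / real n))" by (simp add: u_def)
    finally show "p * exp (N / 2 / real n) + (1 - p) \<le> exp (3 / 4 * N * (p * (1 / real n)))" by (simp add: u_def)
    show "0 \<le> p * exp (N / 2 / real n) + (1 - p)" using p by simp
  qed
  also have "\<dots> = exp (3 / 4 * N * (p * rsum D))"
    using D by (simp only: exp_sum[symmetric] rsum_def sum_distrib_left)
  also have "exp (- N) * exp (3 / 4 * N * (p * rsum D)) = exp (- N / 4)"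
    by (simp add: p(3) exp_add[symmetric])
  finally show ?thesis by simp
qed

text \<open>If every frequency with little bad mass is close to a common multiple of \<open>D\<close>, hence to
  \<open>0\<close> modulo \<open>P\<close>, then the frequencies \<open>\<bar>h\<bar> \<le> H\<close> contribute nonnegatively and all others are
  negligible. So the random subset sum of mean \<open>1\<close> is an integer with probability at least
  \<open>1 / (2 P)\<close>, too much to be accounted for by the values \<open>0\<close> and \<open>\<ge> 2\<close>.\<close>
lemma exists_unit_subsum:
  fixes N Y K H T \<kappa> :: real
  assumes D: "finite D" "rsum D \<ge> 2" and N: "N \<ge> 1" "\<And>n. n \<in> D \<Longrightarrow> N \<le> real n \<and> real n \<le> Y"
    and K: "0 \<le> K" "2 * K \<le> N" and H: "0 \<le> H" "2 * pi * H \<le> N"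
    and near: "\<And>h::int. rsum {n\<in>D. \<not> (\<exists>x. \<bar>real_of_int (x - h)\<bar> \<le> K \<and> int n dvd x)} \<le> \<kappa> \<Longrightarrow>
                 \<exists>x. \<bar>real_of_int (x - h)\<bar> \<le> K \<and> (\<forall>n\<in>D. int n dvd x)"
    and T: "2 * real (Lcm D) \<le> exp T"
    and bad: "T * (rsum D * Y) \<le> K\<^sup>2 * \<kappa>" and mid: "T * Y \<le> H\<^sup>2"
    and cubes: "2 * (2 * pi * H) ^ 3 * rsum D \<le> N\<^sup>2"
    and tail: "4 * real (Lcm D) < exp (N / 4)"
  shows "\<exists>S\<subseteq>D. rsum S = 1"
proof (rule ccontr)
  assume no: "\<not> ?thesis"
  define P where "P = Lcm D"
  define p where "p = 1 / rsum D"
  let ?w = "bernoulli_weight p D"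
  have p: "0 < p" "p \<le> 1 / 2" "p * rsum D = 1" using D by (auto simp: p_def divide_simps)
  have D0: "0 \<notin> D" using N by force
  have P: "n dvd P" if "n \<in> D" for n using that by (simp add: P_def)
  have P0: "P > 0" using D D0 by (simp add: P_def Lcm_0_iff gr0_conv_Suc[symmetric] zero_less_iff_neq_zero)
  have ne: "D \<noteq> {}" using D by (auto simp: rsum_def)
  have Y: "Y \<ge> N" using ne N(2) by (meson all_not_in_conv order_trans)
  have PN: "N \<le> real P"
  proof -
    obtain n where n: "n \<in> D" using ne by blast
    have "n \<le> P" using P[OF n] P0 by (intro dvd_imp_le) auto
    thus ?thesis using N(2)[OF n] by linarith
  qed
  have T0: "exp (- T) * (2 * real P) \<le> 1"
    using T by (simp add: P_def exp_minus field_simps)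
  \<comment> \<open>Up to \<open>H\<close> the phases are small enough for the real part to be
    nonnegative. Between \<open>H\<close> and \<open>K\<close> the integer nearest to
    \<open>h / n\<close> may be taken as 0, so every \<open>n\<close> contributes decay, in total at
    least \<open>H\<^sup>2 / Y >= T\<close>.\<close>
  have major: "Re (char_prod p D h) \<ge> - exp (- T)" if h: "\<bar>real_of_int h\<bar> \<le> K" for h
  proof (cases "\<bar>real_of_int h\<bar> \<le> H")
    case True
    have q: "\<bar>2 * pi * (of_int h / real n)\<bar> \<le> 2 * pi * H / real n" if n: "n \<in> D" for n
      using True by (simp add: abs_mult abs_divide divide_right_mono)
    have q1: "2 * pi * H / real n \<le> 1" if n: "n \<in> D" for n
      using H N(1) N(2)[OF n] by (simp add: divide_le_eq)
    have "Re (char_prod p D h) \<ge> 0"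
    proof (rule Re_char_prod_nonneg[OF D(1) D0])
      show "\<bar>2 * pi * (of_int h / real n)\<bar> \<le> 1" if n: "n \<in> D" for n using q[OF n] q1[OF n] by linarith
      have "(\<Sum>n\<in>D. \<bar>2 * pi * (of_int h / real n)\<bar> ^ 3) \<le> (\<Sum>n\<in>D. (2 * pi * H) ^ 3 / N\<^sup>2 * (1 / real n))"
      proof (rule sum_mono)
        fix n assume n: "n \<in> D"
        have n0: "real n \<ge> N" using N(2)[OF n] by simp
        have "\<bar>2 * pi * (of_int h / real n)\<bar> ^ 3 \<le> (2 * pi * H / real n) ^ 3"
          by (rule power_mono[OF q[OF n]]) simp
        also have "\<dots> = (2 * pi * H) ^ 3 * ((1 / (real n)\<^sup>2) * (1 / real n))"
          by (simp add: power_divide power2_eq_square power3_eq_cube)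
        also have "\<dots> \<le> (2 * pi * H) ^ 3 * ((1 / N\<^sup>2) * (1 / real n))"
          using n0 N(1) H(1) by (intro mult_left_mono mult_right_mono divide_left_mono power_mono) auto
        finally show "\<bar>2 * pi * (of_int h / real n)\<bar> ^ 3 \<le> (2 * pi * H) ^ 3 / N\<^sup>2 * (1 / real n)" by simp
      qed
      also have "\<dots> = (2 * pi * H) ^ 3 / N\<^sup>2 * rsum D" by (simp only: rsum_def sum_distrib_left)
      also have "\<dots> \<le> 1 / 2" using cubes N(1) by (simp add: divide_le_eq)
      finally show "(\<Sum>n\<in>D. \<bar>2 * pi * (of_int h / real n)\<bar> ^ 3) \<le> 1 / 2" .
    qed (use p in auto)
    thus ?thesis using exp_ge_zero[of "- T"] by linarith
  next
    case False
    have "norm (char_prod p D h) \<le> exp (- p * (\<Sum>n\<in>D. H\<^sup>2 / Y * (1 / real n)))"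
    proof (rule norm_char_prod_le)
      fix n assume n: "n \<in> D"
      have n0: "real n \<ge> N" "real n \<le> Y" "real n > 0" using N(2)[OF n] N(1) by auto
      have "\<bar>real_of_int h\<bar> / real n \<le> 1 / 2" using h K n0 by (simp add: divide_le_eq)
      moreover have "H\<^sup>2 / Y * (1 / real n) \<le> (real_of_int h / real n)\<^sup>2"
      proof -
        have "H\<^sup>2 \<le> \<bar>real_of_int h\<bar>\<^sup>2" using False H(1) by (intro power_mono) auto
        hence "H\<^sup>2 / (Y * real n) \<le> \<bar>real_of_int h\<bar>\<^sup>2 / (real n * real n)"
          using n0 by (intro frac_le mult_right_mono) auto
        thus ?thesis by (simp add: power_divide power2_eq_square)
      qed
      ultimately show "\<exists>m::int. \<bar>of_int h / real n - of_int m\<bar> \<le> 1 / 2 \<and>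
          H\<^sup>2 / Y * (1 / real n) \<le> (of_int h / real n - of_int m)\<^sup>2"
        by (intro exI[of _ 0]) simp
    qed (use p D in auto)
    also have "(\<Sum>n\<in>D. H\<^sup>2 / Y * (1 / real n)) = H\<^sup>2 / Y * rsum D" by (simp only: rsum_def sum_distrib_left)
    also have "- p * (H\<^sup>2 / Y * rsum D) = - (H\<^sup>2 / Y) * (p * rsum D)" by simp
    also have "\<dots> \<le> - T" using mid Y N(1) by (simp add: p(3) le_divide_eq)
    finally have "norm (char_prod p D h) \<le> exp (- T)" by simp
    thus ?thesis using abs_Re_le_cmod[of "char_prod p D h"] by linarith
  qed
  have all: "Re (char_prod p D (int h)) \<ge> - exp (- T)" if "h < P" for h
  proof (cases "rsum {n\<in>D. \<not> (\<exists>x. \<bar>real_of_int (x - int h)\<bar> \<le> K \<and> int n dvd x)} \<le> \<kappa>")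
    case True
    obtain x where x: "\<bar>real_of_int (x - int h)\<bar> \<le> K" "\<forall>n\<in>D. int n dvd x" using near[OF True] by blast
    have "P dvd nat \<bar>x\<bar>" unfolding P_def using x(2) by (intro Lcm_least) (simp add: int_dvd_int_iff[symmetric])
    hence "int P dvd x" by (simp add: int_dvd_int_iff[symmetric])
    then obtain k where k: "x = int P * k" by blast
    \<comment> \<open>A multiple of \<open>P\<close> at distance less than \<open>P\<close> from
      some \<open>h\<close> in \<open>[0, P)\<close> can only be \<open>0\<close> or
      \<open>P\<close>; the second case is reflected to the first.\<close>
    have "K < real P" using K PN N(1) by linarith
    have "k = 0 \<or> k = 1"
    proof (rule ccontr)
      assume "\<not> ?thesis"
      hence "k \<le> -1 \<or> k \<ge> 2" by linarith
      hence "x \<le> - int P \<or> x \<ge> 2 * int P"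
        using P0 mult_left_mono[of k "-1" "int P"] mult_left_mono[of 2 k "int P"] unfolding k by auto
      hence "x - int h \<le> - int P \<or> x - int h \<ge> int P" using that by linarith
      hence "real_of_int (x - int h) \<le> - real P \<or> real_of_int (x - int h) \<ge> real P" by linarith
      thus False using x(1) \<open>K < real P\<close> by linarith
    qed
    thus ?thesis
    proof
      assume "k = 0"
      thus ?thesis using x(1) k by (intro major) simp
    next
      assume k1: "k = 1"
      have "Re (char_prod p D (int P - int h)) \<ge> - exp (- T)" using x(1) k k1 by (intro major) simp
      thus ?thesis using P D0 by (simp add: char_prod_reflect)
    qed
  next
    case False
    \<comment> \<open>For \<open>n\<close> in \<open>B\<close> even the nearest multiple of
      \<open>n\<close> is more than \<open>K\<close> away from \<open>h\<close>, so
      \<open>h / n\<close> is more than \<open>K / n\<close> from any integer; \<open>n <= Y\<close>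
      turns the square of this into a multiple of \<open>1 / n\<close>.\<close>
    define B where "B = {n\<in>D. \<not> (\<exists>x. \<bar>real_of_int (x - int h)\<bar> \<le> K \<and> int n dvd x)}"
    define u where "u n = (if n \<in> B then K\<^sup>2 / Y * (1 / real n) else 0)" for n
    have "norm (char_prod p D (int h)) \<le> exp (- p * (\<Sum>n\<in>D. u n))"
    proof (rule norm_char_prod_le)
      fix n assume n: "n \<in> D"
      have n0: "real n \<ge> N" "real n \<le> Y" "real n > 0" using N(2)[OF n] N(1) by auto
      define m where "m = round (real h / real n)"
      have "\<bar>real h / real n - of_int m\<bar> \<le> 1 / 2"
        unfolding m_def using of_int_round_abs_le[of "real h / real n"] by (simp add: abs_minus_commute)
      moreover have "u n \<le> (real h / real n - of_int m)\<^sup>2"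
      proof (cases "n \<in> B")
        case True
        have "\<not> \<bar>real_of_int (int n * m - int h)\<bar> \<le> K" using True unfolding B_def by (metis (no_types, lifting) dvd_triv_left mem_Collect_eq)
        hence "K\<^sup>2 \<le> \<bar>real_of_int (int n * m - int h)\<bar>\<^sup>2" using K by (intro power_mono) auto
        hence "K\<^sup>2 / (Y * real n) \<le> \<bar>real_of_int (int n * m - int h)\<bar>\<^sup>2 / (real n * real n)"
          using n0 by (intro frac_le mult_right_mono) auto
        also have "\<dots> = ((real n * of_int m - real h) / real n)\<^sup>2"
          by (simp add: power_divide power2_eq_square)
        also have "(real n * of_int m - real h) / real n = - (real h / real n - of_int m)"
          using n0 by (simp add: field_simps)
        also have "(- (real h / real n - of_int m))\<^sup>2 = (real h / real n - of_int m)\<^sup>2" by (rule power2_minus)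
        finally show ?thesis using True by (simp add: u_def)
      next
        case False
        thus ?thesis by (simp add: u_def)
      qed
      ultimately show "\<exists>m::int. \<bar>of_int (int h) / real n - of_int m\<bar> \<le> 1 / 2 \<and>
          u n \<le> (of_int (int h) / real n - of_int m)\<^sup>2"
        by (intro exI[of _ m]) simp
    qed (use p D in auto)
    also have "(\<Sum>n\<in>D. u n) = (\<Sum>n\<in>B. K\<^sup>2 / Y * (1 / real n))"
      unfolding u_def using D by (simp only: sum.inter_filter[symmetric]) (simp add: B_def)
    also have "\<dots> = K\<^sup>2 / Y * rsum B" by (simp only: rsum_def sum_distrib_left)
    also have "exp (- p * (K\<^sup>2 / Y * rsum B)) \<le> exp (- T)"
    proof -
      have "T * (rsum D * Y) \<le> K\<^sup>2 * rsum B"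
        using bad False mult_left_mono[of \<kappa> "rsum B" "K\<^sup>2"] unfolding B_def[symmetric] by simp
      hence "T \<le> K\<^sup>2 * rsum B / (rsum D * Y)" using D Y N(1) by (simp add: le_divide_eq)
      thus ?thesis by (simp add: p_def mult_ac)
    qed
    finally show ?thesis using abs_Re_le_cmod[of "char_prod p D (int h)"] by linarith
  qed
  \<comment> \<open>Frequency 0 contributes exactly 1, and \<open>T\<close> is large enough for all
    the others together to cost at most \<open>1 / 2\<close>.\<close>
  have "{..<P} = insert 0 {1..<P}" using P0 by auto
  hence "Re (\<Sum>h<P. char_prod p D (int h)) = 1 + (\<Sum>h\<in>{1..<P}. Re (char_prod p D (int h)))"
    by (simp add: char_prod_def)
  also have "\<dots> \<ge> 1 + (\<Sum>h\<in>{1..<P}. - exp (- T))" using all by (intro add_left_mono sum_mono) auto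
  also have "1 + (\<Sum>h\<in>{1..<P}. - exp (- T)) = 1 - real (P - 1) * exp (- T)" by simp
  also have "\<dots> \<ge> 1 - real P * exp (- T)" by (simp add: mult_right_mono)
  also have "1 - real P * exp (- T) \<ge> 1 / 2" using T0 by (simp add: mult_ac)
  finally have low: "1 / 2 \<le> real P * (\<Sum>S | S \<subseteq> D \<and> rsum S \<in> \<int>. ?w S)"
    using sum_char_prod[OF D(1) P D0, of p] by simp
  have "{S. S \<subseteq> D \<and> rsum S \<in> \<int>} \<subseteq> {{}} \<union> {S. S \<subseteq> D \<and> rsum S \<ge> 2}"
  proof
    fix S assume "S \<in> {S. S \<subseteq> D \<and> rsum S \<in> \<int>}"
    then obtain k :: int where S: "S \<subseteq> D" "rsum S = of_int k" by (auto elim: Ints_cases)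
    have k: "k \<ge> 0" using rsum_nonneg[of S] S by simp
    have "k \<noteq> 1" using no S by auto
    have finS: "finite S" using S D finite_subset by blast
    have "S = {}" if "k = 0"
    proof (rule ccontr)
      assume "S \<noteq> {}"
      moreover have "0 < 1 / real n" if "n \<in> S" for n
      proof -
        have "n \<noteq> 0" using that S(1) D0 by (metis subsetD)
        thus ?thesis by simp
      qed
      ultimately have "rsum S > 0" unfolding rsum_def using finS by (intro sum_pos)
      thus False using S that by simp
    qed
    thus "S \<in> {{}} \<union> {S. S \<subseteq> D \<and> rsum S \<ge> 2}" using S k \<open>k \<noteq> 1\<close> by (cases "k = 0") auto
  qed
  moreover have fin2: "finite {S. S \<subseteq> D \<and> rsum S \<ge> 2}" using D by simp
  ultimately have "(\<Sum>S | S \<subseteq> D \<and> rsum S \<in> \<int>. ?w S) \<le> (\<Sum>S\<in>{{}} \<union> {S. S \<subseteq> D \<and> rsum S \<ge> 2}. ?w S)"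
    using p bernoulli_weight_nonneg[of p D] by (intro sum_mono2) auto
  also have "\<dots> \<le> ?w {} + (\<Sum>S | S \<subseteq> D \<and> rsum S \<ge> 2. ?w S)"
    using fin2 by (subst sum.union_disjoint) (auto simp: rsum_def)
  also have "\<dots> \<le> exp (- N / 4) + exp (- N / 4)"
  proof (rule add_mono)
    show "(\<Sum>S | S \<subseteq> D \<and> rsum S \<ge> 2. ?w S) \<le> exp (- N / 4)"
      by (rule bernoulli_weight_upper_tail) (use D N p in auto)
    \<comment> \<open>Since \<open>N / n <= 1\<close>, each factor \<open>1 - p\<close> is at most
      \<open>exp (- N * p / n)\<close>, which brings in the mean
      \<open>p * rsum D = 1\<close>.\<close>
    have "?w {} = (\<Prod>n\<in>D. 1 - p)" by (simp add: bernoulli_weight_def)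
    also have "\<dots> \<le> (\<Prod>n\<in>D. exp (- N * (p * (1 / real n))))"
    proof (rule prod_mono, intro conjI)
      fix n assume n: "n \<in> D"
      have "N * (p * (1 / real n)) = p * (N / real n)" by simp
      also have "\<dots> \<le> p * 1" using N(1) N(2)[OF n] p by (intro mult_left_mono) (auto simp: divide_le_eq)
      finally have "- p \<le> - N * (p * (1 / real n))" by simp
      moreover have "1 - p \<le> exp (- p)" using exp_ge_add_one_self[of "- p"] by simp
      ultimately show "1 - p \<le> exp (- N * (p * (1 / real n)))" by (meson exp_le_cancel_iff order_trans)
    qed (use p in auto)
    also have "\<dots> = exp (- N * (p * rsum D))" using D by (simp only: exp_sum[symmetric] rsum_def sum_distrib_left)
    also have "\<dots> \<le> exp (- N / 4)" using N(1) by (simp add: p(3))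
    finally show "?w {} \<le> exp (- N / 4)" .
  qed
  finally have "real P * (\<Sum>S | S \<subseteq> D \<and> rsum S \<in> \<int>. ?w S) \<le> real P * (2 * exp (- N / 4))"
    by (intro mult_left_mono) auto
  hence "1 \<le> 4 * real P * exp (- N / 4)" using low by linarith
  also have "\<dots> < exp (N / 4) * exp (- N / 4)" using tail by (intro mult_strict_right_mono) (auto simp: P_def)
  also have "\<dots> = 1" by (simp add: exp_add[symmetric])
  finally show False by simp
qed

section \<open>Rich integers\<close>

lemma card_prime_factors_le_ln:
  assumes "w > 0"
  shows "real (card (prime_factors w)) \<le> 3 / 2 * ln (real w)"
proof -
  have "2 ^ card (prime_factors w) = (\<Prod>p\<in>prime_factors w. 2::nat)" by simp
  also have "\<dots> \<le> \<Prod>(prime_factors w)"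
    by (intro prod_mono) (auto dest: in_prime_factors_imp_prime prime_ge_2_nat)
  also have "\<Prod>(prime_factors w) dvd w"
    by (rule prod_pairwise_coprime_dvd) (auto simp: in_prime_factors_iff intro!: primes_coprime)
  hence "\<Prod>(prime_factors w) \<le> w" using assms by (intro dvd_imp_le)
  finally have "real (2 ^ card (prime_factors w)) \<le> real w" by (rule of_nat_mono)
  hence "ln (2 ^ card (prime_factors w)) \<le> ln (real w)" using assms by (subst ln_le_cancel_iff) auto
  hence "real (card (prime_factors w)) * ln 2 \<le> ln (real w)" by (simp add: ln_realpow)
  moreover have "real (card (prime_factors w)) * (2 / 3) \<le> real (card (prime_factors w)) * ln 2"
    using ln2_ge_two_thirds by (intro mult_left_mono) auto
  ultimately show ?thesis by simp
qed

lemma rsum_le_primes: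
  assumes "finite R" "\<And>r. r \<in> R \<Longrightarrow> primepow r"
  shows "rsum R \<le> rsum {r\<in>R. prime r} + 1"
proof -
  have "R = {r\<in>R. prime r} \<union> {r\<in>R. \<not> prime r}" by auto
  hence "rsum R \<le> rsum {r\<in>R. prime r} + rsum {r\<in>R. \<not> prime r}"
    using assms(1) by (metis (no_types, lifting) finite_Un rsum_Un_le)
  moreover have "rsum {r\<in>R. \<not> prime r} \<le> 1"
    unfolding rsum_def using assms by (intro sum_reciprocal_higher_prime_powers) auto
  ultimately show ?thesis by linarith
qed

lemma finite_nat_le_real: "finite {r::nat. P r \<and> real r \<le> y}"
  by (rule finite_subset[of _ "{..nat \<lfloor>y\<rfloor>}"]) (auto simp: le_nat_floor)

text \<open>Of the constant 6, the primes take 4 and the higher powers 1. The last 1 pays for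
  rounding \<open>z\<close> down to \<open>m\<close>: \<open>z <= m * m\<close> changes
  \<open>ln (ln z)\<close> by at most \<open>ln 2\<close>.\<close>

lemma rsum_prime_powers_between:
  fixes z y :: real
  assumes "z \<ge> 4" "z \<le> y"
  shows "rsum {r. primepow r \<and> real r \<le> y \<and> z < real r} \<le> ln (ln y) - ln (ln z) + 6"
proof -
  define m n where "m = nat \<lfloor>z\<rfloor>" and "n = nat \<lfloor>y\<rfloor>"
  have m4: "m \<ge> 4" unfolding m_def using assms by (simp add: le_nat_iff le_floor_iff)
  have mn: "m \<le> n" unfolding m_def n_def using assms by (intro nat_mono floor_mono)
  have my: "real n \<le> y" unfolding n_def using assms by simp
  have zm: "z < real m + 1" unfolding m_def using assms by linarith
  let ?R = "{r. primepow r \<and> real r \<le> y \<and> z < real r}"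
  have fin: "finite ?R" by (rule finite_subset[OF _ finite_nat_le_real[of primepow y]]) auto
  have "rsum ?R \<le> rsum {r\<in>?R. prime r} + 1" by (rule rsum_le_primes[OF fin]) auto
  also have "rsum {r\<in>?R. prime r} \<le> rsum {p. prime p \<and> m < p \<and> p \<le> n}"
  proof (rule rsum_mono)
    show "{r \<in> ?R. prime r} \<subseteq> {p. prime p \<and> m < p \<and> p \<le> n}"
      using assms by (auto simp: m_def n_def le_nat_floor nat_less_iff floor_less_iff)
  qed auto
  also have "\<dots> \<le> ln (ln (real n)) - ln (ln (real m)) + 4"
    unfolding rsum_def using m4 mn by (intro sum_reciprocal_primes_between) auto
  also have "ln (ln (real n)) \<le> ln (ln y)"
    using my m4 mn by (subst ln_le_cancel_iff) (auto intro: ln_gt_zero)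
  finally have "rsum ?R \<le> ln (ln y) - ln (ln (real m)) + 5" by simp
  moreover have "ln (ln z) - 1 \<le> ln (ln (real m))"
  proof -
    have "z \<le> real m * real m"
      using zm mult_right_mono[of 4 "real m" "real m"] m4 of_nat_mono[OF m4, where 'a=real] by linarith
    hence "ln z \<le> ln (real m * real m)" using assms m4 by (subst ln_le_cancel_iff) auto
    also have "\<dots> = 2 * ln (real m)" using m4 by (simp add: ln_mult)
    finally have "ln (ln z) \<le> ln (2 * ln (real m))"
      using assms m4 by (subst ln_le_cancel_iff) (auto intro: ln_gt_zero)
    also have "\<dots> = ln 2 + ln (ln (real m))" using m4 by (subst ln_mult) auto
    also have "ln (2::real) \<le> 1" using ln_le_minus_one[of "2::real"] by simp
    finally show ?thesis by simp
  qed
  ultimately show ?thesis by linarith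
qed

lemma rsum_prime_powers_le:
  fixes y :: real
  assumes "y \<ge> 4"
  shows "rsum {r. primepow r \<and> real r \<le> y} \<le> ln (ln y) + 9"
proof -
  have e: "{r. primepow r \<and> real r \<le> y} \<subseteq> {r. primepow r \<and> real r \<le> y \<and> 4 < real r} \<union> {1..4}"
    using primepow_gt_0_nat by force
  have "rsum {r. primepow r \<and> real r \<le> y} \<le> rsum ({r. primepow r \<and> real r \<le> y \<and> 4 < real r} \<union> {1..4})"
    using finite_nat_le_real[of primepow y] by (intro rsum_mono[OF _ e]) (auto intro: finite_subset[rotated])
  also have "\<dots> \<le> rsum {r. primepow r \<and> real r \<le> y \<and> 4 < real r} + rsum {1..4}"
    by (intro rsum_Un_le) (auto intro: finite_subset[OF _ finite_nat_le_real[of primepow y]])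
  also have "rsum {1..4} \<le> 3" by (simp add: rsum_def eval_nat_numeral sum.atLeast_Suc_atMost)
  also have "rsum {r. primepow r \<and> real r \<le> y \<and> 4 < real r} \<le> ln (ln y) - ln (ln 4) + 6"
    using assms by (intro rsum_prime_powers_between) auto
  finally have "rsum {r. primepow r \<and> real r \<le> y} \<le> ln (ln y) - ln (ln 4) + 9" by simp
  moreover have "ln (ln (4::real)) \<ge> 0"
  proof -
    have "ln (4::real) = 2 * ln 2" using ln_realpow[of 2 2] by simp
    hence "ln (4::real) \<ge> 1" using ln2_ge_two_thirds by linarith
    thus ?thesis by simp
  qed
  ultimately show ?thesis by linarith
qed

text \<open>Prime powers up to \<open>ln N\<close> have mass \<open>ln (ln (ln N)) + O(1)\<close>.
  Beyond that \<open>w\<close> has only \<open>O(ln N)\<close> primes, each of reciprocal below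
  \<open>1 / ln N\<close>, and higher powers have bounded mass. Applied to the difference of two
  integers, this bounds the prime powers they share.\<close>

lemma rsum_prime_powers_dvd_le:
  fixes w :: nat
  assumes W: "finite W" "\<And>r. r \<in> W \<Longrightarrow> primepow r" and w: "w > 0" "real w \<le> N" and N: "ln N \<ge> 4"
  shows "rsum {r\<in>W. r dvd w} \<le> ln (ln (ln N)) + 12"
proof -
  let ?A = "{r. primepow r \<and> real r \<le> ln N}" and ?B = "{p\<in>prime_factors w. ln N < real p}"
  let ?C = "{r\<in>W. \<not> prime r}"
  have fin: "finite ?A" by (rule finite_nat_le_real)
  have "{r\<in>W. r dvd w} \<subseteq> (?A \<union> ?B) \<union> ?C" using W w by (auto simp: in_prime_factors_iff)
  hence "rsum {r\<in>W. r dvd w} \<le> rsum ((?A \<union> ?B) \<union> ?C)" using W fin by (intro rsum_mono) auto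
  also have "\<dots> \<le> rsum (?A \<union> ?B) + rsum ?C" using W fin by (intro rsum_Un_le) auto
  also have "rsum (?A \<union> ?B) \<le> rsum ?A + rsum ?B" using fin by (intro rsum_Un_le) auto
  also have "rsum ?A \<le> ln (ln (ln N)) + 9" using N by (rule rsum_prime_powers_le)
  also have "rsum ?B \<le> 3 / 2"
  proof -
    have "rsum ?B \<le> (\<Sum>p\<in>?B. 1 / ln N)" unfolding rsum_def using N by (intro sum_mono) (auto intro: frac_le)
    also have "\<dots> = real (card ?B) / ln N" by simp
    also have "\<dots> \<le> (3 / 2 * ln N) / ln N"
    proof (rule divide_right_mono)
      have "real (card ?B) \<le> real (card (prime_factors w))" by (intro of_nat_mono card_mono) auto
      also have "\<dots> \<le> 3 / 2 * ln (real w)" using w by (intro card_prime_factors_le_ln)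
      also have "\<dots> \<le> 3 / 2 * ln N" using w by simp
      finally show "real (card ?B) \<le> 3 / 2 * ln N" .
    qed (use N in auto)
    also have "\<dots> = 3 / 2" using N by simp
    finally show ?thesis .
  qed
  also have "rsum ?C \<le> 1"
    unfolding rsum_def using W by (intro sum_reciprocal_higher_prime_powers) auto
  finally show ?thesis by simp
qed

text \<open>The hypotheses collect what the combinatorics needs. \<open>common\<close> and
  \<open>three\<close> leave no room in \<open>W\<close> for three rich sets; \<open>poor\<close>
  bounds by \<open>\<beta>\<close> the mass carried by divisors of poor integers; \<open>q\<close>
  makes a pruned class outweigh the bad mass plus its poor share.\<close>

locale separated_set =
  fixes C W :: "nat set" and K a z s c \<beta> \<kappa> \<tau> :: real
  assumes finite_C: "finite C" and finite_W: "finite W" and W0: "0 \<notin> W" and z1: "z \<ge> 1" and K1: "K \<ge> 1"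
    and C: "\<And>n. n \<in> C \<Longrightarrow> n > 0 \<and> exact_pps n \<subseteq> W \<and> a \<le> real (card (exact_pps n)) \<and>
                2 * K * z ^ card (exact_pps n) < real n"
    and common: "\<And>(h::int) x y. x \<noteq> y \<Longrightarrow> \<bar>real_of_int (x - h)\<bar> \<le> K \<Longrightarrow> \<bar>real_of_int (y - h)\<bar> \<le> K \<Longrightarrow>
                rsum {r\<in>W. int r dvd x \<and> int r dvd y} \<le> c"
    and three: "rsum W \<le> 3 * s - 3 * c"
    and poor: "exp (1 - a + exp 1 * rsum {r\<in>W. real r > z} + exp 1 * s) \<le> \<beta>"
    and \<tau>: "\<tau> \<ge> 0" "\<tau> * rsum W \<le> 1 / 4" and q: "\<And>q. q \<in> W \<Longrightarrow> \<kappa> + 1 / real q * \<beta> < \<tau> / real q"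
    and small: "\<kappa> + \<beta> \<le> 1 / 2"
begin

definition bad :: "nat set \<Rightarrow> int \<Rightarrow> nat set" where
  "bad D h = {n\<in>D. \<not> (\<exists>x. \<bar>real_of_int (x - h)\<bar> \<le> K \<and> int n dvd x)}"

definition near :: "nat set \<Rightarrow> int \<Rightarrow> bool" where
  "near D h \<longleftrightarrow> (\<exists>x. \<bar>real_of_int (x - h)\<bar> \<le> K \<and> (\<forall>n\<in>D. int n dvd x))"

text \<open>The ambient set \<open>U\<close> varies: after restriction to the divisors of one
  integer, only prime powers dividing that integer are counted.\<close>

definition rich :: "nat set \<Rightarrow> int \<Rightarrow> int \<Rightarrow> bool" where
  "rich U h x \<longleftrightarrow> \<bar>real_of_int (x - h)\<bar> \<le> K \<and> rsum {r\<in>U. int r dvd x} > s"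

definition pruned :: "nat set \<Rightarrow> bool" where
  "pruned D \<longleftrightarrow> (\<forall>n\<in>D. \<forall>q\<in>exact_pps n. rsum {m\<in>D. q \<in> exact_pps m} \<ge> \<tau> / real q)"

text \<open>Outside the bad set each element of \<open>A\<close> divides an integer near
  \<open>h\<close>, which by assumption is not rich, so the Rankin bound applies.\<close>

lemma rsum_not_rich_le:
  assumes D: "D \<subseteq> C" and U: "U \<subseteq> W" "\<forall>n\<in>D. exact_pps n \<subseteq> U"
    and q: "\<And>n. n \<in> D \<Longrightarrow> q = 1 \<or> q \<in> exact_pps n"
    and bad: "rsum (bad D h) \<le> \<kappa>" and not_rich: "\<And>n x. n \<in> A \<Longrightarrow> rich U h x \<Longrightarrow> \<not> int n dvd x"
    and A: "A \<subseteq> D"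
  shows "rsum A \<le> \<kappa> + 1 / real q * \<beta>"
proof -
  let ?G = "A - bad D h"
  have finD: "finite D" and finU: "finite U" using D U finite_C finite_W finite_subset by blast+
  have finA: "finite A" using A finD finite_subset by blast
  have finb: "finite (bad D h)" using finD by (simp add: bad_def)
  have "rsum ?G \<le> 1 / real q * exp (1 - a + exp 1 * rsum {r\<in>U. real r > z} + exp 1 * s)"
  proof (rule rsum_poor_le[where K = K and h = h])
    show "0 \<notin> U" using U W0 by auto
    show "n > 0 \<and> exact_pps n \<subseteq> U \<and> (q = 1 \<or> q \<in> exact_pps n) \<and> a \<le> real (card (exact_pps n)) \<and>
          2 * K * z ^ card (exact_pps n) < real n" if "n \<in> ?G" for n
      using that A D C[of n] U(2) q[of n] by blast
    show "\<exists>x. \<bar>real_of_int (x - h)\<bar> \<le> K \<and> int n dvd x \<and> rsum {r \<in> U. int r dvd x} \<le> s" if n: "n \<in> ?G" for n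
    proof -
      obtain x where x: "\<bar>real_of_int (x - h)\<bar> \<le> K" "int n dvd x" using n A by (auto simp: bad_def)
      have "\<not> rich U h x" using not_rich[of n x] n x by blast
      thus ?thesis using x by (auto simp: rich_def not_less)
    qed
  qed (use finA finU z1 in auto)
  also have "\<dots> \<le> 1 / real q * exp (1 - a + exp 1 * rsum {r\<in>W. real r > z} + exp 1 * s)"
  proof -
    have "rsum {r\<in>U. real r > z} \<le> rsum {r\<in>W. real r > z}" using U finite_W by (intro rsum_mono) auto
    thus ?thesis by (intro mult_left_mono) (auto intro!: mult_left_mono)
  qed
  also have "\<dots> \<le> 1 / real q * \<beta>" using poor by (intro mult_left_mono) auto
  finally have "rsum ?G \<le> 1 / real q * \<beta>" .
  moreover have "rsum A \<le> rsum (bad D h \<union> ?G)" using finA finb by (intro rsum_mono) auto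
  moreover have "rsum (bad D h \<union> ?G) \<le> rsum (bad D h) + rsum ?G" using finA finb by (intro rsum_Un_le) auto
  ultimately show ?thesis using bad by linarith
qed

text \<open>Otherwise all elements with exact prime power \<open>q\<close> are bad or divide only
  poor integers near \<open>h\<close>, and their mass falls below what pruning guarantees.\<close>

lemma exists_rich_multiple:
  assumes D: "D \<subseteq> C" and U: "U \<subseteq> W" "\<forall>n\<in>D. exact_pps n \<subseteq> U" and "pruned D"
    and bad: "rsum (bad D h) \<le> \<kappa>" and nq: "n \<in> D" "q \<in> exact_pps n"
  shows "\<exists>x. rich U h x \<and> int q dvd x"
proof (rule ccontr)
  assume no: "\<not> ?thesis"
  let ?A = "{m\<in>D. q \<in> exact_pps m}"
  have "rsum ?A \<le> \<kappa> + 1 / real q * \<beta>"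
  proof (rule rsum_not_rich_le[where D = ?A])
    have "rsum (bad ?A h) \<le> rsum (bad D h)"
      using D finite_C by (intro rsum_mono) (auto simp: bad_def intro: finite_subset)
    thus "rsum (bad ?A h) \<le> \<kappa>" using bad by linarith
    show "\<not> int m dvd x" if "m \<in> ?A" "rich U h x" for m x
    proof
      assume "int m dvd x"
      moreover have "int q dvd int m" using exact_pps_dvd that by (simp add: int_dvd_int_iff)
      ultimately have "int q dvd x" by (metis dvd_trans)
      thus False using no that by blast
    qed
  qed (use D U in auto)
  also have "\<dots> < \<tau> / real q" using nq U by (intro q) auto
  also have "\<dots> \<le> rsum ?A" using \<open>pruned D\<close> nq by (auto simp: pruned_def)
  finally show False by simp
qed

text \<open>By inclusion-exclusion the union would have mass above \<open>3 * s - 3 * c\<close>,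
  more than all of \<open>W\<close>.\<close>

lemma no_three_rich:
  assumes A: "A1 \<subseteq> W" "A2 \<subseteq> W" "A3 \<subseteq> W" and s: "rsum A1 > s" "rsum A2 > s" "rsum A3 > s"
    and c: "rsum (A1 \<inter> A2) \<le> c" "rsum (A1 \<inter> A3) \<le> c" "rsum (A2 \<inter> A3) \<le> c"
  shows False
proof -
  have fin: "finite A1" "finite A2" "finite A3" using A finite_W finite_subset by blast+
  have "rsum (A1 \<union> A2) + rsum (A1 \<inter> A2) = rsum A1 + rsum A2"
    unfolding rsum_def using fin by (intro sum.union_inter) auto
  moreover have "rsum (A1 \<union> A2 \<union> A3) + rsum ((A1 \<union> A2) \<inter> A3) = rsum (A1 \<union> A2) + rsum A3"
    unfolding rsum_def using fin by (intro sum.union_inter) auto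
  moreover have "rsum ((A1 \<union> A2) \<inter> A3) \<le> rsum (A1 \<inter> A3) + rsum (A2 \<inter> A3)"
    using fin rsum_Un_le[of "A1 \<inter> A3" "A2 \<inter> A3"] by (simp add: Int_Un_distrib2)
  moreover have "rsum (A1 \<union> A2 \<union> A3) \<le> rsum W" using A by (intro rsum_mono finite_W) auto
  ultimately show False using s c three by linarith
qed

text \<open>A rich \<open>x\<close> exists. If it is not a common multiple of \<open>D\<close>, some
  exact prime power \<open>r\<close> of some \<open>m\<close> fails to divide it, and the rich
  multiple of \<open>r\<close> is a second integer.\<close>

lemma two_rich:
  assumes D: "D \<subseteq> C" "D \<noteq> {}" and U: "U \<subseteq> W" "\<forall>n\<in>D. exact_pps n \<subseteq> U" and "pruned D"
    and bad: "rsum (bad D h) \<le> \<kappa>" and "\<not> near D h"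
  obtains x y where "x \<noteq> y" "rich U h x" "rich U h y"
proof -
  obtain n where n: "n \<in> D" using D by blast
  \<comment> \<open>Only \<open>n = 1\<close> has no prime power, and it is excluded by
    \<open>n > 2 * K >= 2\<close>.\<close>
  have "exact_pps n \<noteq> {}"
  proof
    assume e: "exact_pps n = {}"
    hence "2 * K < real n" "n = 1" using C[of n] n D prod_exact_pps[of n] by auto
    thus False using K1 by simp
  qed
  then obtain q where "q \<in> exact_pps n" by blast
  then obtain x where x: "rich U h x" using exists_rich_multiple[OF D(1) U \<open>pruned D\<close> bad n] by blast
  then obtain m where m: "m \<in> D" "\<not> int m dvd x" using \<open>\<not> near D h\<close> by (auto simp: near_def rich_def)
  then obtain r where r: "r \<in> exact_pps m" "\<not> int r dvd x"
    using dvd_if_exact_pps_dvd[of m x] C[of m] D by blast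
  then obtain y where y: "rich U h y" "int r dvd y"
    using exists_rich_multiple[OF D(1) U \<open>pruned D\<close> bad m(1)] by blast
  show ?thesis by (rule that[OF _ x y(1)]) (use r(2) y(2) in auto)
qed

lemma exists_pruned:
  assumes "D \<subseteq> C"
  obtains D' where "D' \<subseteq> D" "pruned D'" "rsum D' \<ge> rsum D - 1 / 4"
proof (rule exists_pruned_subset[of D W \<tau>])
  fix D' assume "D' \<subseteq> D" "rsum D' \<ge> rsum D - \<tau> * rsum W"
    and "\<And>n q. n \<in> D' \<Longrightarrow> q \<in> exact_pps n \<Longrightarrow> rsum {m\<in>D'. q \<in> exact_pps m} \<ge> \<tau> / real q"
  thus ?thesis using that[of D'] \<tau> by (auto simp: pruned_def)
qed (use assms C finite_C finite_W finite_subset \<tau> W0 in \<open>blast+\<close>)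

text \<open>If the pruned set splits at some \<open>h\<close>, it is passed to the divisors of one
  of the two rich integers and pruned again. A further splitting would give a third rich set, so two
  rounds suffice.\<close>

theorem exists_indecomposable_subset:
  assumes "rsum C > 6"
  obtains D where "D \<subseteq> C" "rsum D \<ge> 2" "\<And>h. rsum (bad D h) \<le> \<kappa> \<Longrightarrow> near D h"
proof -
  obtain D0 where D0: "D0 \<subseteq> C" "pruned D0" "rsum D0 \<ge> rsum C - 1 / 4" using exists_pruned[of C] by blast
  show ?thesis
  proof (cases "\<forall>h. rsum (bad D0 h) \<le> \<kappa> \<longrightarrow> near D0 h")
    case True
    thus ?thesis using that[of D0] D0 assms by auto
  next
    case False
    then obtain h where h: "rsum (bad D0 h) \<le> \<kappa>" "\<not> near D0 h" by blast
    have W: "\<forall>n\<in>D0. exact_pps n \<subseteq> W" using D0 C by blast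
    have "D0 \<noteq> {}" using D0 assms by (auto simp: rsum_def)
    then obtain x y where xy: "x \<noteq> y" "rich W h x" "rich W h y"
      using two_rich[OF D0(1) _ subset_refl W D0(2) h] by metis
    have only: "x' = x \<or> x' = y" if "rich W h x'" for x'
    proof (rule ccontr)
      assume "\<not> ?thesis"
      moreover have "{r\<in>W. int r dvd u} \<inter> {r\<in>W. int r dvd v} = {r\<in>W. int r dvd u \<and> int r dvd v}" for u v
        by auto
      ultimately show False
        using no_three_rich[of "{r\<in>W. int r dvd x}" "{r\<in>W. int r dvd y}" "{r\<in>W. int r dvd x'}"] xy that
          common[of x y h] common[of x x' h] common[of y x' h] by (auto simp: rich_def)
    qed
    let ?X = "{n\<in>D0. int n dvd x}" and ?Y = "{n\<in>D0. int n dvd y}"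
    let ?L = "{n\<in>D0. \<not> int n dvd x \<and> \<not> int n dvd y}"
    have finD0: "finite D0" using D0 finite_C finite_subset by blast
    \<comment> \<open>No prime power is prescribed here, hence \<open>q = 1\<close>. With at most
      \<open>1 / 2\<close> lost to \<open>?L\<close> and \<open>1 / 4\<close> to pruning, more than
      \<open>21 / 4\<close> is shared by \<open>?X\<close> and \<open>?Y\<close>, so one has at
      least \<open>9 / 4\<close>.\<close>
    have "rsum ?L \<le> \<kappa> + 1 / real 1 * \<beta>"
      by (rule rsum_not_rich_le[OF D0(1) subset_refl W _ h(1)]) (use only in auto)
    moreover have "D0 = ?X \<union> ?Y \<union> ?L" by auto
    hence "rsum D0 \<le> rsum (?X \<union> ?Y) + rsum ?L" "rsum (?X \<union> ?Y) \<le> rsum ?X + rsum ?Y"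
      using finD0 rsum_Un_le[of "?X \<union> ?Y" ?L] rsum_Un_le[of ?X ?Y] by auto
    ultimately have "rsum ?X \<ge> 9 / 4 \<or> rsum ?Y \<ge> 9 / 4" using D0(3) assms small by auto
    then obtain u v where uv: "u \<noteq> v" "rich W h u" "rich W h v" and X: "rsum {n\<in>D0. int n dvd u} \<ge> 9 / 4"
      using xy by metis
    obtain D where D: "D \<subseteq> {n\<in>D0. int n dvd u}" "pruned D" "rsum D \<ge> rsum {n\<in>D0. int n dvd u} - 1 / 4"
      using exists_pruned[of "{n\<in>D0. int n dvd u}"] D0(1) by blast
    have DC: "D \<subseteq> C" using D D0 by blast
    have D2: "rsum D \<ge> 2" using D(3) X by simp
    hence ne: "D \<noteq> {}" by (auto simp: rsum_def)
    let ?U = "{r\<in>W. int r dvd u}"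
    have U: "\<forall>n\<in>D. exact_pps n \<subseteq> ?U"
    proof (intro ballI subsetI)
      fix n q assume n: "n \<in> D" and q: "q \<in> exact_pps n"
      hence "int q dvd int n" using exact_pps_dvd by (simp add: int_dvd_int_iff)
      moreover have "int n dvd u" using n D by blast
      ultimately show "q \<in> ?U" using q n DC C dvd_trans by blast
    qed
    have "near D h'" if bad: "rsum (bad D h') \<le> \<kappa>" for h'
    proof (rule ccontr)
      assume "\<not> near D h'"
      then obtain a b where ab: "a \<noteq> b" "rich ?U h' a" "rich ?U h' b"
        using two_rich[OF DC ne _ U D(2) bad] by blast
      \<comment> \<open>The frequency \<open>h'\<close> need not be related to \<open>h\<close>. The
        sets of \<open>a\<close> and \<open>b\<close> consist of divisors of \<open>u\<close>, so
        each meets that of \<open>v\<close> only in common divisors of \<open>u\<close> and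
        \<open>v\<close>, while they meet each other in common divisors of \<open>a\<close> and
        \<open>b\<close>.\<close>
      let ?A1 = "{r\<in>W. int r dvd v}" and ?A2 = "{r\<in>?U. int r dvd a}" and ?A3 = "{r\<in>?U. int r dvd b}"
      have "rsum (?A1 \<inter> ?A2) \<le> rsum {r\<in>W. int r dvd u \<and> int r dvd v}"
        "rsum (?A1 \<inter> ?A3) \<le> rsum {r\<in>W. int r dvd u \<and> int r dvd v}"
        "rsum (?A2 \<inter> ?A3) \<le> rsum {r\<in>W. int r dvd a \<and> int r dvd b}"
        using finite_W by (auto intro!: rsum_mono)
      thus False
        using no_three_rich[of ?A1 ?A2 ?A3] uv ab common[of u v h] common[of a b h'] by (auto simp: rich_def)
    qed
    thus ?thesis using that[of D] DC D2 by blast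
  qed
qed

end

section \<open>Asymptotics and conclusion\<close>

lemma exp_1_le: "exp 1 \<le> (272 / 100 :: real)"
proof -
  have "exp 1 < exp (ln (272 / 100 :: real))" using ln_272_gt_1 by (subst exp_less_cancel_iff)
  thus ?thesis by simp
qed

lemma rsum_le_ln:
  assumes "\<And>n. n \<in> D \<Longrightarrow> n > 0 \<and> real n \<le> Y" "Y \<ge> 1"
  shows "rsum D \<le> 1 + ln Y"
proof -
  define m where "m = nat \<lfloor>Y\<rfloor>"
  have m: "m \<ge> 1" "real m \<le> Y" using assms(2) by (auto simp: m_def le_nat_iff)
  have "D \<subseteq> {1..m}" using assms(1) by (fastforce simp: m_def le_nat_floor)
  hence "rsum D \<le> rsum {1..m}" by (intro rsum_mono) auto
  also have "\<dots> = harm m" by (simp add: rsum_def harm_def inverse_eq_divide)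
  also have "\<dots> \<le> 1 + ln (real m)"
  proof -
    have "(\<Sum>i\<in>{1..m}. 1 / real i) \<le> 1 + ln (real m)" using m(1)
    proof (induction m rule: nat_induct_at_least)
      case (Suc n)
      have "ln (real n / real (Suc n)) \<le> real n / real (Suc n) - 1" using Suc by (intro ln_le_minus_one) auto
      also have "\<dots> = - (1 / real (Suc n))" by (simp add: field_simps)
      finally have "1 / real (Suc n) \<le> ln (real (Suc n)) - ln (real n)" using Suc by (simp add: ln_div)
      thus ?case using Suc by simp
    qed simp
    thus ?thesis by (simp add: harm_def inverse_eq_divide)
  qed
  also have "ln (real m) \<le> ln Y" using m by simp
  finally show ?thesis by simp
qed

text \<open>The exact prime powers of \<open>n\<close> are distinct integers in
  \<open>{1..m}\<close>, so their product \<open>n\<close> divides \<open>m!\<close>.\<close>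

lemma Lcm_smooth_le:
  fixes y :: real
  assumes D: "\<And>n. n \<in> D \<Longrightarrow> n > 0 \<and> (\<forall>q\<in>exact_pps n. real q \<le> y)" and y: "y \<ge> 1"
  shows "real (Lcm D) \<le> exp (y * ln y)"
proof -
  define m where "m = nat \<lfloor>y\<rfloor>"
  have m: "m \<ge> 1" "real m \<le> y" using y by (auto simp: m_def le_nat_iff)
  have "Lcm D dvd fact m"
  proof (rule Lcm_least)
    fix n assume n: "n \<in> D"
    have "exact_pps n \<subseteq> {1..m}"
    proof
      fix q assume q: "q \<in> exact_pps n"
      hence "q > 0" "real q \<le> y" using D[OF n] exact_pps_pos by auto
      thus "q \<in> {1..m}" by (auto simp: m_def le_nat_floor)
    qed
    hence "\<Prod>(exact_pps n) dvd \<Prod>{1..m}" by (intro prod_dvd_prod_subset) auto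
    thus "n dvd fact m" using D[OF n] by (simp add: prod_exact_pps fact_prod)
  qed
  hence "Lcm D \<le> fact m" by (rule dvd_imp_le) simp
  hence "real (Lcm D) \<le> fact m" by (metis of_nat_fact of_nat_le_iff)
  also have "\<dots> \<le> real m ^ m" using fact_le_power[of m, where 'a=real] by simp
  also have "\<dots> = exp (real m * ln (real m))" using m by (simp add: exp_of_nat_mult)
  also have "\<dots> \<le> exp (y * ln y)" using m y by (intro exp_mono mult_mono) auto
  finally show ?thesis .
qed

text \<open>Two margins depend on the richness threshold \<open>35 / 100\<close>: tripled it exceeds
  1 by \<open>1 / 20\<close>, which absorbs the overlaps, and
  \<open>272 / 100 * (35 / 100) = 0.952 < 99 / 100\<close> makes the exponent in the second claim
  tend to minus infinity.\<close>

lemma eventually_asymptotics: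
  fixes \<theta> \<eta> :: real
  assumes "\<theta> > 0" "\<theta> < 1 / 4" "\<eta> > 0"
  shows "eventually (\<lambda>N::real. N \<ge> 1 \<and> ln N \<ge> 4 \<and> ln (ln N) \<ge> 1 \<and> N powr \<theta> \<ge> 4
     \<and> 3 * ln (ln (ln N)) + 45 \<le> 1 / 20 * ln (ln N)
     \<and> N powr (1 / (16 * ln (ln N))) \<ge> 4 \<and> 1 / (16 * ln (ln N)) \<le> \<theta>) at_top" (is ?A)
   and "eventually (\<lambda>N::real. exp (1 - 99 / 100 * ln (ln N) + 272 / 100 * (ln (16 * ln (ln N)) + 6) + 272 / 100 * (35 / 100 * ln (ln N)))
           < 1 / (8 * (ln (ln N) + 9))) at_top" (is ?B)
   and "eventually (\<lambda>N::real. N powr \<theta> * N powr (- (1 / 4)) < 1 / (8 * (ln (ln N) + 9)) \<and> N powr (- (1 / 4)) \<le> 1 / 4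
           \<and> 2 * N powr (7 / 8) < N \<and> 2 * N powr (3 / 4) \<le> N \<and> 2 * pi * N powr (5 / 8) \<le> N
           \<and> (1 + N powr \<theta> * ln N) * (3 * ln N) \<le> N powr \<theta> * N powr \<eta>
           \<and> 2 * (2 * pi * N powr (5 / 8)) ^ 3 * (3 * ln N) \<le> N\<^sup>2
           \<and> 2 + N powr \<theta> * ln N < N / 4) at_top" (is ?C)
proof -
  show ?A using assms by (intro eventually_conj; real_asymp)
  show ?B by real_asymp
  show ?C using assms by (intro eventually_conj; real_asymp)
qed

lemma exists_unit_subsum_of_smooth_normal:
  fixes N \<theta> \<delta> :: real
  assumes par: "\<theta> > 0" "\<delta> > 0" "\<delta> + \<theta> < 1 / 4"
    and \<epsilon>: "\<And>n. real n \<ge> N \<Longrightarrow> \<epsilon> n \<le> 1 / 100"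
    and A: "N \<ge> 1" "ln N \<ge> 4" "ln (ln N) \<ge> 1" "N powr \<theta> \<ge> 4"
      "3 * ln (ln (ln N)) + 45 \<le> 1 / 20 * ln (ln N)"
      "N powr (1 / (16 * ln (ln N))) \<ge> 4" "1 / (16 * ln (ln N)) \<le> \<theta>"
    and B: "exp (1 - 99 / 100 * ln (ln N) + 272 / 100 * (ln (16 * ln (ln N)) + 6) + 272 / 100 * (35 / 100 * ln (ln N)))
           < 1 / (8 * (ln (ln N) + 9))"
    and E: "N powr \<theta> * N powr (- (1 / 4)) < 1 / (8 * (ln (ln N) + 9))" "N powr (- (1 / 4)) \<le> 1 / 4"
      "2 * N powr (7 / 8) < N" "2 * N powr (3 / 4) \<le> N" "2 * pi * N powr (5 / 8) \<le> N"
      "(1 + N powr \<theta> * ln N) * (3 * ln N) \<le> N powr \<theta> * N powr (1 / 4 - \<delta> - \<theta>)"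
      "2 * (2 * pi * N powr (5 / 8)) ^ 3 * (3 * ln N) \<le> N\<^sup>2"
      "2 + N powr \<theta> * ln N < N / 4"
    and CN: "C \<subseteq> smooth_normal_ints \<epsilon> N (N powr (1 + \<delta>)) \<theta>" "rsum C > 6"
  shows "\<exists>S\<subseteq>C. rsum S = 1"
proof -
  define k where "k = ln (ln N)"
  define W where "W = {r. primepow r \<and> real r \<le> N powr \<theta>}"
  define K where "K = N powr (3 / 4)"
  \<comment> \<open>The exponent is chosen so that \<open>omega n <= 2 * k\<close> prime powers
    below \<open>z\<close> multiply to at most \<open>N powr (1 / 8)\<close>; then
    \<open>2 * K * N powr (1 / 8) = 2 * N powr (7 / 8)\<close> is still below
    \<open>N\<close>.\<close>
  define z where "z = N powr (1 / (16 * k))"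
  define \<beta> where "\<beta> = exp (1 - 99 / 100 * k + 272 / 100 * (ln (16 * k) + 6) + 272 / 100 * (35 / 100 * k))"
  \<comment> \<open>It must stay below the pruning level \<open>\<tau> / q\<close> for every
    \<open>q <= N powr \<theta>\<close>, which works because
    \<open>\<theta> < 1 / 4\<close>.\<close>
  define \<kappa> where "\<kappa> = N powr (- (1 / 4))"
  define \<tau> where "\<tau> = 1 / (4 * (k + 9))"
  define Y where "Y = N powr (1 + \<delta>)"
  have k1: "k \<ge> 1" and lnN: "ln N > 0" and N0: "N > 0"
    using A(1-3) unfolding k_def by linarith+
  have \<theta>1: "\<theta> < 1" "1 + \<delta> < 5 / 4" using par by auto
  have lnY: "ln Y = (1 + \<delta>) * ln N" and lnW: "ln (N powr \<theta>) = \<theta> * ln N" using N0 by (auto simp: Y_def ln_powr)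
  have lnz: "ln z = ln N / (16 * k)" using N0 by (simp add: z_def ln_powr)
  have W_le: "rsum W \<le> k + 9"
  proof -
    have "rsum W \<le> ln (ln (N powr \<theta>)) + 9" unfolding W_def using A(4) by (rule rsum_prime_powers_le)
    also have "ln (ln (N powr \<theta>)) \<le> ln (ln N)"
      unfolding lnW using par \<theta>1 lnN by (subst ln_le_cancel_iff) auto
    finally show ?thesis by (simp add: k_def)
  qed
  \<comment> \<open>Since \<open>ln z = ln N / (16 * k)\<close>, the range from \<open>z\<close> to
    \<open>N powr \<theta>\<close> is short on the \<open>ln ln\<close> scale and has mass only
    \<open>O(ln k)\<close>.\<close>
  have V_le: "rsum {r\<in>W. z < real r} \<le> ln (16 * k) + 6"
  proof -
    have zy: "z \<le> N powr \<theta>" unfolding z_def using A k_def by (intro powr_mono) auto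
    have "{r\<in>W. z < real r} = {r. primepow r \<and> real r \<le> N powr \<theta> \<and> z < real r}" by (auto simp: W_def)
    hence "rsum {r\<in>W. z < real r} \<le> ln (ln (N powr \<theta>)) - ln (ln z) + 6"
      using rsum_prime_powers_between[OF _ zy] A(6) by (simp add: z_def k_def)
    also have "ln (ln (N powr \<theta>)) \<le> ln (ln N)"
      unfolding lnW using par \<theta>1 lnN by (subst ln_le_cancel_iff) auto
    also have "ln (ln z) = ln (ln N) - ln (16 * k)" unfolding lnz using lnN k1 by (subst ln_div) auto
    finally show ?thesis by simp
  qed
  have mem: "n > 0 \<and> N \<le> real n \<and> real n \<le> Y \<and> exact_pps n \<subseteq> W \<and> 99 / 100 * k \<le> real (card (exact_pps n))
      \<and> 2 * K * z ^ card (exact_pps n) < real n" if "n \<in> C" for n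
  proof -
    have n: "N \<le> real n" "real n \<le> Y"
      and pp: "\<And>p a. prime p \<Longrightarrow> 1 \<le> a \<Longrightarrow> p ^ a dvd n \<Longrightarrow> real (p ^ a) \<le> N powr \<theta>"
      and om: "\<bar>real (omega n) / ln (ln (real n)) - 1\<bar> \<le> \<epsilon> n"
      using that CN(1) by (auto simp: smooth_normal_ints_def smooth_ints_def Y_def)
    have n0: "n > 0" using n A(1) by (cases n) auto
    have sub: "exact_pps n \<subseteq> W"
    proof
      fix q assume q: "q \<in> exact_pps n"
      show "q \<in> W" using q by (rule exact_pps_prime_power) (use q pp exact_pps_primepow in \<open>auto simp: W_def\<close>)
    qed
    have card: "card (exact_pps n) = omega n" by (simp add: card_exact_pps omega_def)
    have lnn: "ln N \<le> ln (real n)" "ln (real n) \<le> 2 * ln N"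
    proof -
      show "ln N \<le> ln (real n)" using n N0 by (subst ln_le_cancel_iff) auto
      have "ln (real n) \<le> ln Y" using n n0 N0 by (subst ln_le_cancel_iff) (auto simp: Y_def)
      also have "\<dots> \<le> 2 * ln N" unfolding lnY using \<theta>1 lnN by (intro mult_right_mono) auto
      finally show "ln (real n) \<le> 2 * ln N" .
    qed
    define l where "l = ln (ln (real n))"
    \<comment> \<open>As \<open>n <= N^2\<close>, passing from \<open>ln (ln N)\<close> to
      \<open>ln (ln n)\<close> adds at most \<open>ln 2\<close>.\<close>
    have l: "k \<le> l" "l \<le> k + 7 / 10"
    proof -
      show "k \<le> l" unfolding k_def l_def using lnn lnN by (subst ln_le_cancel_iff) auto
      have "l \<le> ln (2 * ln N)" unfolding l_def using lnn lnN by (subst ln_le_cancel_iff) auto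
      also have "\<dots> = ln 2 + k" unfolding k_def using lnN by (subst ln_mult) auto
      finally show "l \<le> k + 7 / 10" using ln2_le_25_over_36 by simp
    qed
    have "\<bar>real (omega n) / l - 1\<bar> \<le> 1 / 100" using om \<epsilon>[OF n(1)] by (simp add: l_def)
    hence "99 / 100 \<le> real (omega n) / l" "real (omega n) / l \<le> 101 / 100" by linarith+
    hence om': "99 / 100 * l \<le> real (omega n)" "real (omega n) \<le> 101 / 100 * l"
      using l k1 by (auto simp: le_divide_eq divide_le_eq)
    have "z ^ omega n = N powr (1 / (16 * k) * real (omega n))"
      using N0 powr_realpow[of z "omega n", symmetric] by (simp add: z_def powr_powr)
    also have "\<dots> \<le> N powr (1 / 8)"
    proof (rule powr_mono)
      have "real (omega n) \<le> 2 * k" using om' l k1 by linarith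
      thus "1 / (16 * k) * real (omega n) \<le> 1 / 8" using k1 by (simp add: divide_le_eq)
    qed (use A in auto)
    finally have "2 * K * z ^ omega n \<le> 2 * K * N powr (1 / 8)" by (intro mult_left_mono) (auto simp: K_def)
    also have "\<dots> = 2 * N powr (7 / 8)" by (simp add: K_def powr_add[symmetric])
    also have "\<dots> < N" by (rule E)
    finally show ?thesis using n n0 sub card om' l by simp
  qed
  have finC: "finite C"
    by (rule finite_subset[OF _ finite_nat_le_real[of "\<lambda>_. True" Y]]) (use mem in auto)
  have finW: "finite W" unfolding W_def by (rule finite_nat_le_real)
  have K: "K \<ge> 1" "2 * K \<le> N" using A E by (auto simp: K_def ge_one_powr_ge_zero)
  interpret separated_set C W K "99 / 100 * k" z "35 / 100 * k" "ln k + 12" \<beta> \<kappa> \<tau>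
  proof
    show "0 \<notin> W" by (simp add: W_def)
    show "1 \<le> z" using A(6) by (simp add: z_def k_def)
    show "rsum {r\<in>W. int r dvd x \<and> int r dvd y} \<le> ln k + 12"
      if "x \<noteq> y" "\<bar>real_of_int (x - h)\<bar> \<le> K" "\<bar>real_of_int (y - h)\<bar> \<le> K" for h x y :: int
    proof -
      define w where "w = nat \<bar>x - y\<bar>"
      have w0: "w > 0" using that by (simp add: w_def)
      have "real w = \<bar>real_of_int (x - h) - real_of_int (y - h)\<bar>" by (simp add: w_def)
      hence wN: "real w \<le> N" using that K by linarith
      have "{r\<in>W. int r dvd x \<and> int r dvd y} \<subseteq> {r\<in>W. r dvd w}"
        by (auto simp: w_def nat_abs_dvd_iff int_dvd_int_iff[symmetric] dvd_diff)
      hence "rsum {r\<in>W. int r dvd x \<and> int r dvd y} \<le> rsum {r\<in>W. r dvd w}" using finW by (intro rsum_mono) auto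
      also have "\<dots> \<le> ln (ln (ln N)) + 12"
        by (rule rsum_prime_powers_dvd_le[OF finW _ w0 wN A(2)]) (simp add: W_def)
      finally show ?thesis by (simp add: k_def)
    qed
    show "rsum W \<le> 3 * (35 / 100 * k) - 3 * (ln k + 12)" using W_le A(5) by (simp add: k_def)
    show "exp (1 - 99 / 100 * k + exp 1 * rsum {r \<in> W. z < real r} + exp 1 * (35 / 100 * k)) \<le> \<beta>"
    proof -
      have "exp 1 * rsum {r \<in> W. z < real r} \<le> 272 / 100 * (ln (16 * k) + 6)"
        using V_le exp_1_le rsum_nonneg by (intro mult_mono) auto
      moreover have "exp 1 * (35 / 100 * k) \<le> 272 / 100 * (35 / 100 * k)"
        using exp_1_le k1 by (intro mult_right_mono) auto
      ultimately show ?thesis unfolding \<beta>_def by (intro exp_mono add_mono) auto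
    qed
    show "0 \<le> \<tau>" using k1 by (simp add: \<tau>_def)
    show "\<tau> * rsum W \<le> 1 / 4" using W_le k1 by (simp add: \<tau>_def divide_le_eq)
    show "\<kappa> + 1 / real q * \<beta> < \<tau> / real q" if "q \<in> W" for q
    proof -
      have q: "real q > 0" "real q \<le> N powr \<theta>" using that primepow_gt_0_nat by (auto simp: W_def)
      have "real q * \<kappa> \<le> N powr \<theta> * \<kappa>" using q by (intro mult_right_mono) (auto simp: \<kappa>_def)
      moreover have "N powr \<theta> * \<kappa> < \<tau> / 2" using E(1) by (simp add: \<kappa>_def \<tau>_def k_def)
      moreover have "\<beta> < \<tau> / 2" using B by (simp add: \<beta>_def \<tau>_def k_def)
      ultimately have "real q * \<kappa> + \<beta> < \<tau>" by linarith
      hence "(real q * \<kappa> + \<beta>) / real q < \<tau> / real q" using q by (intro divide_strict_right_mono)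
      thus ?thesis using q by (simp add: add_divide_distrib)
    qed
    have "\<beta> < 1 / (8 * (k + 9))" using B by (simp add: \<beta>_def k_def)
    also have "\<dots> \<le> 1 / 4" using k1 by (simp add: divide_le_eq)
    finally show "\<kappa> + \<beta> \<le> 1 / 2" using E(2) by (simp add: \<kappa>_def)
  qed (use finC finW K mem in auto)
  obtain D where D: "D \<subseteq> C" "rsum D \<ge> 2" and near: "\<And>h. rsum (bad D h) \<le> \<kappa> \<Longrightarrow> near D h"
    using exists_indecomposable_subset[OF CN(2)] by blast
  define T where "T = 1 + N powr \<theta> * ln N"
  have T0: "T \<ge> 0" using lnN by (simp add: T_def)
  have Y1: "Y \<ge> 1" using A par by (simp add: Y_def ge_one_powr_ge_zero)
  have D_le: "rsum D \<le> 3 * ln N"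
  proof -
    have "rsum D \<le> 1 + ln Y" using D mem Y1 by (intro rsum_le_ln) auto
    \<comment> \<open>The crude factor 2 suffices because
      \<open>1 + \<delta> < 5 / 4\<close>.\<close>
    also have "ln Y \<le> 2 * ln N" unfolding lnY using \<theta>1 lnN by (intro mult_right_mono) auto
    also have "1 + 2 * ln N \<le> 3 * ln N" using A(2) by simp
    finally show ?thesis by simp
  qed
  have P: "real (Lcm D) \<le> exp (N powr \<theta> * ln N)"
  proof -
    have "real (Lcm D) \<le> exp (N powr \<theta> * ln (N powr \<theta>))"
      by (rule Lcm_smooth_le) (use D mem A in \<open>auto simp: W_def subset_iff\<close>)
    also have "N powr \<theta> * ln (N powr \<theta>) \<le> N powr \<theta> * ln N"
      unfolding lnW using \<theta>1 lnN by (intro mult_left_mono) auto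
    finally show ?thesis by simp
  qed
  have expT: "2 * exp (N powr \<theta> * ln N) \<le> exp T"
    using exp_ge_add_one_self[of 1] by (simp add: T_def exp_add)
  \<comment> \<open>This is where the full condition \<open>\<delta> + \<theta> < 1 / 4\<close>
    enters: \<open>T * Y\<close> is about \<open>N powr (1 + \<delta> + \<theta>)\<close> up to
    logarithms, and the target \<open>N powr (5 / 4)\<close> equals both
    \<open>K\<^sup>2 * \<kappa>\<close> and the square of \<open>H = N powr (5 / 8)\<close>.\<close>
  have TY: "T * (3 * ln N) * Y \<le> N powr (5 / 4)"
  proof -
    have "T * (3 * ln N) * Y \<le> (N powr \<theta> * N powr (1 / 4 - \<delta> - \<theta>)) * Y"
      using E(6) Y1 by (intro mult_right_mono) (auto simp: T_def)
    also have "\<dots> = N powr (5 / 4)" by (simp add: Y_def powr_add[symmetric])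
    finally show ?thesis .
  qed
  have "\<exists>S\<subseteq>D. rsum S = 1"
  proof (rule exists_unit_subsum[where N = N and Y = Y and K = K and H = "N powr (5 / 8)" and T = T and \<kappa> = \<kappa>])
    show "finite D" using D finC finite_subset by blast
    show "N \<le> real n \<and> real n \<le> Y" if "n \<in> D" for n using that D mem by blast
    show "\<exists>x. \<bar>real_of_int (x - h)\<bar> \<le> K \<and> (\<forall>n\<in>D. int n dvd x)"
      if "rsum {n \<in> D. \<not> (\<exists>x. \<bar>real_of_int (x - h)\<bar> \<le> K \<and> int n dvd x)} \<le> \<kappa>" for h
      using near[of h] that unfolding bad_def near_def by blast
    show "2 * real (Lcm D) \<le> exp T" using P expT by linarith
    have "T * (rsum D * Y) \<le> T * (3 * ln N) * Y"
      using D_le T0 Y1 by (simp add: mult_left_mono mult_right_mono mult.assoc)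
    also have "\<dots> \<le> N powr (5 / 4)" by (rule TY)
    also have "\<dots> = K\<^sup>2 * \<kappa>" by (simp add: K_def \<kappa>_def power2_eq_square powr_add[symmetric])
    finally show "T * (rsum D * Y) \<le> K\<^sup>2 * \<kappa>" .
    have "T * Y \<le> (T * (3 * ln N)) * Y"
      using T0 Y1 A(2) mult_left_mono[of 1 "3 * ln N" T] by (intro mult_right_mono) auto
    also have "\<dots> \<le> N powr (5 / 4)" by (rule TY)
    also have "\<dots> = (N powr (5 / 8))\<^sup>2" by (simp add: power2_eq_square powr_add[symmetric])
    finally show "T * Y \<le> (N powr (5 / 8))\<^sup>2" .
    have "2 * (2 * pi * N powr (5 / 8)) ^ 3 * rsum D \<le> 2 * (2 * pi * N powr (5 / 8)) ^ 3 * (3 * ln N)"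
      using D_le by (intro mult_left_mono) auto
    also have "\<dots> \<le> N\<^sup>2" by (rule E)
    finally show "2 * (2 * pi * N powr (5 / 8)) ^ 3 * rsum D \<le> N\<^sup>2" .
    have "4 * real (Lcm D) \<le> 2 * exp T" using P expT by linarith
    also have "\<dots> \<le> exp (1 + T)" using exp_ge_add_one_self[of 1] by (simp add: exp_add)
    also have "\<dots> < exp (N / 4)" using E(8) by (simp add: T_def)
    finally show "4 * real (Lcm D) < exp (N / 4)" .
  qed (use D A E K in auto)
  thus ?thesis using D by blast
qed

theorem mainTheorem2:
  fixes \<theta> \<delta> :: real and \<epsilon> :: "nat \<Rightarrow> real"
  assumes "\<theta> > 0" and "\<delta> > 0" and "\<delta> + \<theta> < 1 / 4"
    and "\<epsilon> \<longlonglongrightarrow> 0"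
  shows "\<exists>N0 :: real. \<forall>N \<ge> N0. \<forall>C \<subseteq> smooth_normal_ints \<epsilon> N (N powr (1 + \<delta>)) \<theta>.
           (\<Sum>n\<in>C. 1 / real n) > 6 \<longrightarrow> (\<exists>S \<subseteq> C. (\<Sum>n\<in>S. 1 / real n) = 1)"
proof -
  have "eventually (\<lambda>n. \<epsilon> n < 1 / 100) sequentially" using assms(4) by (rule order_tendstoD) simp
  then obtain n0 where n0: "\<And>n. n \<ge> n0 \<Longrightarrow> \<epsilon> n < 1 / 100" by (auto simp: eventually_sequentially)
  \<comment> \<open>The bound is made uniform in \<open>n >= N\<close>, since all elements of
    \<open>C\<close> are at least \<open>N\<close>.\<close>
  have \<epsilon>: "eventually (\<lambda>N::real. \<forall>n. real n \<ge> N \<longrightarrow> \<epsilon> n \<le> 1 / 100) at_top"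
    using eventually_ge_at_top[of "real n0"]
  proof eventually_elim
    case (elim N)
    show ?case
    proof (intro allI impI)
      fix n assume "real n \<ge> N"
      hence "n \<ge> n0" using elim by linarith
      thus "\<epsilon> n \<le> 1 / 100" using n0 less_imp_le by blast
    qed
  qed
  have par: "\<theta> < 1 / 4" "1 / 4 - \<delta> - \<theta> > 0" using assms by auto
  have "eventually (\<lambda>N::real. \<forall>C \<subseteq> smooth_normal_ints \<epsilon> N (N powr (1 + \<delta>)) \<theta>.
           rsum C > 6 \<longrightarrow> (\<exists>S \<subseteq> C. rsum S = 1)) at_top"
    using \<epsilon> eventually_asymptotics[OF assms(1) par]
  proof eventually_elim
    case (elim N)
    show ?case
    proof (intro allI impI)
      fix C assume "C \<subseteq> smooth_normal_ints \<epsilon> N (N powr (1 + \<delta>)) \<theta>" "6 < rsum C"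
      thus "\<exists>S\<subseteq>C. rsum S = 1"
        using elim by (intro exists_unit_subsum_of_smooth_normal[OF assms(1-3), where N = N and \<epsilon> = \<epsilon>]) auto
    qed
  qed
  thus ?thesis by (auto simp: eventually_at_top_linorder rsum_def)
qed

end
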